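(* Let $n\ge 2$ be an integer, let $\mathcal{N}$ be a nontrivial nest of a complex Hilbert space $\mathbf{H}$ and let $\mathcal{T}(\mathcal{N})$ be the associated nest algebra. Then for every multiplicative generalized Jordan $n$-derivation $\Delta:\mathcal{T}(\mathcal{N})\rightarrow\mathcal{T}(\mathcal{N})$ there exist $\mu\in\mathbb{C}1$ and a derivation $\delta:\mathcal{T}(\mathcal{N})\rightarrow\mathcal{T}(\mathcal{N})$ such that $\Delta(t)=\mu t+\delta(t)$ for all $t\in\mathcal{T}(\mathcal{N})$.
   Context: A nest $\mathcal{N}$ of $\mathbf{H}$ is a chain of closed subspaces of $\mathbf{H}$ containing $\{0\}$ and $\mathbf{H}$ and closed under arbitrary intersections and closed linear spans; it is nontrivial if $\mathcal{N}\neq\{\{0\},\mathbf{H}\}$. The nest algebra $\mathcal{T}(\mathcal{N})$ is the algebra of all bounded linear operators $T$ on $\mathbf{H}$ with $T(N)\subseteq N$ for all $N\in\mathcal{N}$; $1$ is the identity operator. In a ring $\mathfrak{A}$ the Jordan product is $t_1\circ t_2=t_1t_2+t_2t_1$. Set $q_1(t_1)=t_1$ and $q_n(t_1,\ldots,t_n)=q_{n-1}(t_1,\ldots,t_{n-1})\circ t_n$ for $n\ge 2$. A map $\delta:\mathfrak{A}\to\mathfrak{A}$ (not assumed additive) is a multiplicative Jordan $n$-derivation if $\delta(q_n(t_1,\ldots,t_n))=\sum_{i=1}^n q_n(t_1,\ldots,t_{i-1},\delta(t_i),t_{i+1},\ldots,t_n)$ for all $t_1,\ldots,t_n\in\mathfrak{A}$.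 A map $\Delta:\mathfrak{A}\to\mathfrak{A}$ (not assumed additive) is a multiplicative generalized Jordan $n$-derivation if there exists a multiplicative Jordan $n$-derivation $\delta:\mathfrak{A}\to\mathfrak{A}$ (not assumed additive) such that $\Delta(q_n(t_1,\ldots,t_n))=q_n(\Delta(t_1),t_2,\ldots,t_n)+\sum_{i=2}^n q_n(t_1,\ldots,t_{i-1},\delta(t_i),t_{i+1},\ldots,t_n)$ for all $t_1,\ldots,t_n\in\mathfrak{A}$. A derivation is an additive map $d$ (not assumed linear) with $d(t_1t_2)=d(t_1)t_2+t_1d(t_2)$ for all $t_1,t_2$. *)

theory Defs
  imports "HOL-Analysis.Analysis" "HOL-Algebra.Ring"
begin

section \<open>Complex Hilbert spaces\<close>

class complex_vector = real_vector +
  fixes scaleC :: "complex \<Rightarrow> 'a \<Rightarrow> 'a"  (infixr "*\<^sub>C" 75)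
  assumes scaleC_add_right: "c *\<^sub>C (x + y) = c *\<^sub>C x + c *\<^sub>C y"
    and scaleC_add_left: "(b + c) *\<^sub>C x = b *\<^sub>C x + c *\<^sub>C x"
    and scaleC_scaleC: "b *\<^sub>C c *\<^sub>C x = (b * c) *\<^sub>C x"
    and scaleC_of_real: "complex_of_real r *\<^sub>C x = r *\<^sub>R x"

lemma scaleC_one: "1 *\<^sub>C x = (x :: 'a :: complex_vector)"
  using scaleC_of_real[of 1 x] by simp

global_interpretation complex_vector: vector_space "scaleC :: complex \<Rightarrow> 'a \<Rightarrow> 'a :: complex_vector"
  defines csubspace = complex_vector.subspace
    and cspan = complex_vector.span
  by unfold_locales (simp_all add: scaleC_add_right scaleC_add_left scaleC_scaleC scaleC_one)

text \<open>The inner product is linear in the first and conjugate-linear in the second argument.\<close>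

class complex_inner = complex_vector + real_normed_vector +
  fixes cinner :: "'a \<Rightarrow> 'a \<Rightarrow> complex"
  assumes cinner_commute: "cinner x y = cnj (cinner y x)"
    and cinner_add_left: "cinner (x + y) z = cinner x z + cinner y z"
    and cinner_scaleC_left: "cinner (c *\<^sub>C x) y = c * cinner x y"
    and cinner_self_nonneg: "0 \<le> Re (cinner x x)"
    and cinner_self_eq_zero: "cinner x x = 0 \<longleftrightarrow> x = 0"
    and norm_eq_sqrt_cinner: "norm x = sqrt (Re (cinner x x))"

class complex_hilbert_space = complex_inner + complete_space

instantiation complex :: complex_hilbert_space
begin

definition scaleC_complex :: "complex \<Rightarrow> complex \<Rightarrow> complex"
  where "scaleC_complex c x = c * x"

definition cinner_complex :: "complex \<Rightarrow> complex \<Rightarrow> complex"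
  where "cinner_complex x y = x * cnj y"

instance
  by standard (auto simp: scaleC_complex_def cinner_complex_def algebra_simps scaleR_conv_of_real
      cmod_def power2_eq_square)

end

instantiation prod :: (complex_hilbert_space, complex_hilbert_space) complex_hilbert_space
begin

definition scaleC_prod :: "complex \<Rightarrow> 'a \<times> 'b \<Rightarrow> 'a \<times> 'b"
  where "scaleC_prod c x = (c *\<^sub>C fst x, c *\<^sub>C snd x)"

definition cinner_prod :: "'a \<times> 'b \<Rightarrow> 'a \<times> 'b \<Rightarrow> complex"
  where "cinner_prod x y = cinner (fst x) (fst y) + cinner (snd x) (snd y)"

instance
proof
  fix x y z :: "'a \<times> 'b" and b c :: complex and r :: real
  show "c *\<^sub>C (x + y) = c *\<^sub>C x + c *\<^sub>C y"
    "(b + c) *\<^sub>C x = b *\<^sub>C x + c *\<^sub>C x"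
    "b *\<^sub>C c *\<^sub>C x = (b * c) *\<^sub>C x"
    "complex_of_real r *\<^sub>C x = r *\<^sub>R x"
    by (simp_all add: scaleC_prod_def scaleC_add_right scaleC_add_left scaleC_scaleC
        scaleC_of_real prod_eq_iff)
  show "cinner x y = cnj (cinner y x)"
    by (simp add: cinner_prod_def cinner_commute[of "fst x"] cinner_commute[of "snd x"])
  show "cinner (x + y) z = cinner x z + cinner y z"
    "cinner (c *\<^sub>C x) y = c * cinner x y"
    by (simp_all add: cinner_prod_def scaleC_prod_def cinner_add_left cinner_scaleC_left algebra_simps)
  show nonneg: "0 \<le> Re (cinner x x)"
    by (simp add: cinner_prod_def cinner_self_nonneg)
  show n: "norm x = sqrt (Re (cinner x x))"
    by (simp add: cinner_prod_def norm_prod_def norm_eq_sqrt_cinner cinner_self_nonneg)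
  have "cinner (0 :: 'a) 0 = 0" "cinner (0 :: 'b) 0 = 0"
    by (simp_all add: cinner_self_eq_zero)
  then show "cinner x x = 0 \<longleftrightarrow> x = 0"
    using n by (metis add.right_neutral cinner_prod_def fst_zero norm_eq_zero real_sqrt_zero snd_zero zero_complex.sel(1))
qed

end

section \<open>Nest algebras\<close>

definition nest :: "'a :: complex_hilbert_space set set \<Rightarrow> bool"
  where "nest \<N> \<longleftrightarrow>
    (\<forall>N\<in>\<N>. csubspace N \<and> closed N) \<and>
    (\<forall>M\<in>\<N>. \<forall>N\<in>\<N>. M \<subseteq> N \<or> N \<subseteq> M) \<and>
    {0} \<in> \<N> \<and> UNIV \<in> \<N> \<and>
    (\<forall>\<F>. \<F> \<subseteq> \<N> \<longrightarrow> \<Inter>\<F> \<in> \<N>) \<and>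
    (\<forall>\<F>. \<F> \<subseteq> \<N> \<longrightarrow> closure (cspan (\<Union>\<F>)) \<in> \<N>)"

definition nontrivial_nest :: "'a :: complex_hilbert_space set set \<Rightarrow> bool"
  where "nontrivial_nest \<N> \<longleftrightarrow> nest \<N> \<and> \<N> \<noteq> {{0}, UNIV}"

text \<open>The type of bounded operators in HOL-Analysis is that of the real-linear ones, so
  complex homogeneity is required separately.\<close>

definition nest_algebra :: "'a :: complex_hilbert_space set set \<Rightarrow> ('a \<Rightarrow>\<^sub>L 'a) ring"
  where "nest_algebra \<N> =
    \<lparr>carrier = {T. (\<forall>c x. blinfun_apply T (c *\<^sub>C x) = c *\<^sub>C blinfun_apply T x) \<and>
                   (\<forall>N\<in>\<N>. blinfun_apply T ` N \<subseteq> N)},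
     monoid.mult = (o\<^sub>L), one = id_blinfun, ring.zero = 0, add = (+)\<rparr>"

lemma norm_scaleC: "norm (c *\<^sub>C x) = cmod c * norm (x :: 'a :: complex_inner)"
proof -
  have "cinner (c *\<^sub>C x) (c *\<^sub>C x) = (c * cnj c) * cinner x x"
    using cinner_commute[of x "c *\<^sub>C x"] cinner_commute[of x x]
    by (simp add: cinner_scaleC_left)
  also have "c * cnj c = complex_of_real ((cmod c)\<^sup>2)"
    by (simp only: complex_norm_square[symmetric] of_real_power)
  finally have "Re (cinner (c *\<^sub>C x) (c *\<^sub>C x)) = (cmod c)\<^sup>2 * Re (cinner x x)"
    by (simp del: of_real_power)
  then show ?thesis
    by (simp add: norm_eq_sqrt_cinner[of x] norm_eq_sqrt_cinner[of "c *\<^sub>C x"] real_sqrt_mult)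
qed

lift_definition scalar_operator :: "complex \<Rightarrow> 'a \<Rightarrow>\<^sub>L 'a :: complex_hilbert_space"
  is "\<lambda>c x. c *\<^sub>C x"
proof (rule bounded_linear_intro)
  fix c :: complex and x y :: 'a and r :: real
  show "c *\<^sub>C (x + y) = c *\<^sub>C x + c *\<^sub>C y"
    by (rule scaleC_add_right)
  show "c *\<^sub>C r *\<^sub>R x = r *\<^sub>R c *\<^sub>C x"
    by (simp add: scaleC_scaleC mult.commute flip: scaleC_of_real)
  show "norm (c *\<^sub>C x) \<le> norm x * cmod c"
    by (simp add: norm_scaleC)
qed

lemma ring_nest_algebra:
  assumes "nest \<N>"
  shows "ring (nest_algebra \<N>)"
proof -
  have sub: "csubspace N" if "N \<in> \<N>" for N
    using assms that by (simp add: nest_def)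
  note closure_rules = complex_vector.subspace_add[OF sub] complex_vector.subspace_0[OF sub]
    complex_vector.subspace_neg[OF sub]
  have neg: "\<exists>y\<in>carrier (nest_algebra \<N>). y + x = 0" if "x \<in> carrier (nest_algebra \<N>)" for x
    using that
    by (intro bexI[of _ "- x"])
      (auto simp: nest_algebra_def blinfun.minus_left complex_vector.scale_minus_right image_subset_iff closure_rules)
  show ?thesis
  proof (intro ringI abelian_groupI monoidI)
    show "\<exists>y\<in>carrier (nest_algebra \<N>). y \<oplus>\<^bsub>nest_algebra \<N>\<^esub> x = \<zero>\<^bsub>nest_algebra \<N>\<^esub>"
      if "x \<in> carrier (nest_algebra \<N>)" for x
      using neg[OF that] by (simp add: nest_algebra_def)
  qed (auto simp: nest_algebra_def blinfun.add_left blinfun.add_right scaleC_add_right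
      image_subset_iff closure_rules algebra_simps intro!: blinfun_eqI)
qed

section \<open>Jordan derivations and their generalizations\<close>

definition jordan_product :: "('r, 'm) ring_scheme \<Rightarrow> 'r \<Rightarrow> 'r \<Rightarrow> 'r"
  where "jordan_product R x y = (x \<otimes>\<^bsub>R\<^esub> y) \<oplus>\<^bsub>R\<^esub> (y \<otimes>\<^bsub>R\<^esub> x)"

text \<open>\<open>jordan_q R n t\<close> is \<open>q\<^sub>n(t\<^sub>1, \<dots>, t\<^sub>n)\<close>, where \<open>t\<close> is indexed from \<open>1\<close>;
  the value at \<open>n = 0\<close> is a dummy.\<close>

fun jordan_q :: "('r, 'm) ring_scheme \<Rightarrow> nat \<Rightarrow> (nat \<Rightarrow> 'r) \<Rightarrow> 'r"
  where
    "jordan_q R 0 t = \<zero>\<^bsub>R\<^esub>"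
  | "jordan_q R (Suc 0) t = t 1"
  | "jordan_q R (Suc (Suc n)) t = jordan_product R (jordan_q R (Suc n) t) (t (Suc (Suc n)))"

definition mult_jordan_derivation :: "('r, 'm) ring_scheme \<Rightarrow> nat \<Rightarrow> ('r \<Rightarrow> 'r) \<Rightarrow> bool"
  where "mult_jordan_derivation R n \<delta> \<longleftrightarrow>
    \<delta> \<in> carrier R \<rightarrow> carrier R \<and>
    (\<forall>t \<in> {1..n} \<rightarrow> carrier R.
      \<delta> (jordan_q R n t) = (\<Oplus>\<^bsub>R\<^esub>i\<in>{1..n}. jordan_q R n (t(i := \<delta> (t i)))))"

definition mult_generalized_jordan_derivation ::
    "('r, 'm) ring_scheme \<Rightarrow> nat \<Rightarrow> ('r \<Rightarrow> 'r) \<Rightarrow> bool"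
  where "mult_generalized_jordan_derivation R n \<Delta> \<longleftrightarrow>
    \<Delta> \<in> carrier R \<rightarrow> carrier R \<and>
    (\<exists>\<delta>. mult_jordan_derivation R n \<delta> \<and>
      (\<forall>t \<in> {1..n} \<rightarrow> carrier R.
        \<Delta> (jordan_q R n t) =
          jordan_q R n (t(1 := \<Delta> (t 1))) \<oplus>\<^bsub>R\<^esub>
          (\<Oplus>\<^bsub>R\<^esub>i\<in>{2..n}. jordan_q R n (t(i := \<delta> (t i))))))"

definition derivation :: "('r, 'm) ring_scheme \<Rightarrow> ('r \<Rightarrow> 'r) \<Rightarrow> bool"
  where "derivation R d \<longleftrightarrow>
    d \<in> carrier R \<rightarrow> carrier R \<and>
    (\<forall>x\<in>carrier R. \<forall>y\<in>carrier R. d (x \<oplus>\<^bsub>R\<^esub> y) = d x \<oplus>\<^bsub>R\<^esub> d y) \<and>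
    (\<forall>x\<in>carrier R. \<forall>y\<in>carrier R. d (x \<otimes>\<^bsub>R\<^esub> y) = (d x \<otimes>\<^bsub>R\<^esub> y) \<oplus>\<^bsub>R\<^esub> (x \<otimes>\<^bsub>R\<^esub> d y))"

end

theory Submission
  imports Defs
begin

text \<open>Fix a subspace \<open>N\<close> strictly between \<open>0\<close> and the whole space in the nest, a projection \<open>P\<close> onto
\<open>N\<close>, and \<open>Q = 1 - P\<close>.  Every operator \<open>T\<close> of the nest algebra maps \<open>N\<close> into itself, so
\<open>Q T P = 0\<close>: with respect to \<open>P\<close> the algebra consists of upper triangular two by two block
matrices.  The corner \<open>P T Q\<close> is unconstrained, because such an operator kills every nest
subspace below \<open>N\<close> and maps the others into \<open>N\<close>.  Hence it contains enough rank-one operators to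
detect both diagonal blocks.  The locale \<open>triangular_algebra\<close> isolates these two properties, and
almost all of the argument takes place there.

Let \<open>\<delta>\<close> be a multiplicative Jordan \<open>n\<close>-derivation of such an algebra.  Evaluating the identity at
tuples in which all entries but one or two are \<open>1\<close> or \<open>P\<close> gives \<open>\<delta> 1 = 0\<close> and \<open>\<delta> P\<close> in the corner
(\<open>leibniz_at_p\<close>, \<open>leibniz_unit\<close>).  Padding with \<open>1\<close> leaves a binary identity distorted
by powers of \<open>2\<close>.  That distortion can be removed although \<open>\<delta>\<close> is not yet known to be homogeneous
(\<open>leibniz_binary\<close>), so \<open>\<delta>\<close> satisfies the Leibniz rule for the Jordan product of two elements.
After subtraction of an inner derivation \<open>\<delta> P = 0\<close>, and then \<open>\<delta>\<close> respects the blocks.  Additivity on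
the corner comes from \<open>a + b = (P + b) \<circ> (a + Q)\<close>, and it passes with multiplicativity to the
diagonal blocks because these act faithfully on the corner
(\<open>jordan_derivation_vanishing_at_p\<close>).  Hence \<open>\<delta>\<close> is a derivation.

For the generalized map \<open>\<Delta>\<close>, padding with \<open>1\<close> yields \<open>\<Delta> x = (c \<circ> x) / 2 + \<delta> x\<close> with \<open>c = \<Delta> 1\<close>.
Substituting this back shows \<open>c \<circ> (x \<circ> y) = (c \<circ> x) \<circ> y\<close>, which forces \<open>c\<close> to be central
(\<open>generalized_jordan_n_derivation\<close>).  The centre of a nest algebra with a nontrivial nest
consists of scalars (\<open>center_scalar\<close>), again by testing against rank-one operators.\<close>

section \<open>Triangular algebras\<close>

lemma scaleR_double:
  fixes x :: "'a::real_vector"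
  shows "(2 * c) *\<^sub>R x = c *\<^sub>R x + c *\<^sub>R x" "(c * 2) *\<^sub>R x = c *\<^sub>R x + c *\<^sub>R x"
    "2 *\<^sub>R x = x + x" "(c * (2 * e)) *\<^sub>R x = (c * e) *\<^sub>R x + (c * e) *\<^sub>R x"
  by (simp_all add: scaleR_2 flip: scaleR_left_distrib)

text \<open>The multiplication is total and bilinear on the whole type, whereas the triangular shape is
required on the subalgebra \<open>A\<close> only.  With \<open>A\<close> a nest algebra, the multiplication is the composition
of arbitrary operators, so that computations inside a product need no membership conditions.\<close>

locale triangular_algebra =
  fixes mult :: "'a::real_vector \<Rightarrow> 'a \<Rightarrow> 'a"  (infixl "\<cdot>" 70)
    and A :: "'a set" and p q :: 'a
  assumes add_left: "(x + y) \<cdot> z = x \<cdot> z + y \<cdot> z"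
    and add_right: "x \<cdot> (y + z) = x \<cdot> y + x \<cdot> z"
    and scaleR_left: "(r *\<^sub>R x) \<cdot> y = r *\<^sub>R (x \<cdot> y)"
    and scaleR_right: "x \<cdot> (r *\<^sub>R y) = r *\<^sub>R (x \<cdot> y)"
    and assoc: "(x \<cdot> y) \<cdot> z = x \<cdot> (y \<cdot> z)"
    and subspace_A: "subspace A"
    and mult_closed: "x \<in> A \<Longrightarrow> y \<in> A \<Longrightarrow> x \<cdot> y \<in> A"
    and p_closed: "p \<in> A" and q_closed: "q \<in> A"
    and pp: "p \<cdot> p = p" and qq: "q \<cdot> q = q" and pq: "p \<cdot> q = 0" and qp: "q \<cdot> p = 0"
    and unit_left: "(p + q) \<cdot> x = x" and unit_right: "x \<cdot> (p + q) = x"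
    and lower_zero: "x \<in> A \<Longrightarrow> q \<cdot> x \<cdot> p = 0"
    and faithful_left:
      "x \<in> A \<Longrightarrow> (\<And>a. a \<in> A \<Longrightarrow> (p \<cdot> x \<cdot> p) \<cdot> (p \<cdot> a \<cdot> q) = 0) \<Longrightarrow> p \<cdot> x \<cdot> p = 0"
    and faithful_right:
      "x \<in> A \<Longrightarrow> (\<And>a. a \<in> A \<Longrightarrow> (p \<cdot> a \<cdot> q) \<cdot> (q \<cdot> x \<cdot> q) = 0) \<Longrightarrow> q \<cdot> x \<cdot> q = 0"
begin

sublocale left: Modules.additive "\<lambda>x. x \<cdot> y" for y
  by standard (rule add_left)
sublocale right: Modules.additive "\<lambda>y. x \<cdot> y" for x
  by standard (rule add_right)

lemmas zero_mult [simp] = left.zero right.zero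

lemmas distrib = add_left add_right scaleR_left scaleR_right left.diff right.diff
  left.minus right.minus

lemmas closed [simp, intro] = mult_closed p_closed q_closed
  subspace_add[OF subspace_A] subspace_diff[OF subspace_A] subspace_neg[OF subspace_A]
  subspace_scale[OF subspace_A] subspace_0[OF subspace_A]

text \<open>The three blocks of a triangular matrix: upper left, upper right (the corner) and lower right.\<close>

definition ul where "ul x = p \<cdot> x \<cdot> p"
definition ur where "ur x = p \<cdot> x \<cdot> q"
definition lr where "lr x = q \<cdot> x \<cdot> q"

lemma parts_closed [simp, intro]:
  assumes "x \<in> A" shows "ul x \<in> A" "ur x \<in> A" "lr x \<in> A"
  using assms by (auto simp: ul_def ur_def lr_def)

lemma parts_linear [simp]:
  "ul (x + y) = ul x + ul y" "ur (x + y) = ur x + ur y" "lr (x + y) = lr x + lr y"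
  "ul (x - y) = ul x - ul y" "ur (x - y) = ur x - ur y" "lr (x - y) = lr x - lr y"
  "ul (- x) = - ul x" "ur (- x) = - ur x" "lr (- x) = - lr x"
  "ul (r *\<^sub>R x) = r *\<^sub>R ul x" "ur (r *\<^sub>R x) = r *\<^sub>R ur x" "lr (r *\<^sub>R x) = r *\<^sub>R lr x"
  "ul 0 = 0" "ur 0 = 0" "lr 0 = 0"
  by (simp_all add: ul_def ur_def lr_def distrib)

lemma absorb:
  "p \<cdot> (p \<cdot> x) = p \<cdot> x" "q \<cdot> (q \<cdot> x) = q \<cdot> x" "p \<cdot> (q \<cdot> x) = 0" "q \<cdot> (p \<cdot> x) = 0"
  by (simp_all add: pp qq pq qp distrib flip: assoc)

lemma parts_parts [simp]:
  "ul (ul x) = ul x" "ur (ul x) = 0" "lr (ul x) = 0"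
  "ul (ur x) = 0" "ur (ur x) = ur x" "lr (ur x) = 0"
  "ul (lr x) = 0" "ur (lr x) = 0" "lr (lr x) = lr x"
  "ul p = p" "ur p = 0" "lr p = 0" "ul q = 0" "ur q = 0" "lr q = q"
  by (simp_all add: ul_def ur_def lr_def assoc pp qq pq qp absorb distrib)

lemma parts_products [simp]:
  "p \<cdot> ul x = ul x" "ul x \<cdot> p = ul x" "q \<cdot> ul x = 0" "ul x \<cdot> q = 0"
  "p \<cdot> ur x = ur x" "ur x \<cdot> q = ur x" "q \<cdot> ur x = 0" "ur x \<cdot> p = 0"
  "q \<cdot> lr x = lr x" "lr x \<cdot> q = lr x" "p \<cdot> lr x = 0" "lr x \<cdot> p = 0"
  "ul x \<cdot> lr y = 0" "lr x \<cdot> ul y = 0" "ur x \<cdot> ur y = 0"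
  "ur x \<cdot> ul y = 0" "lr x \<cdot> ur y = 0"
  by (simp_all add: ul_def ur_def lr_def assoc pp qq pq qp absorb distrib)

lemma parts_sum: assumes "x \<in> A" shows "ul x + ur x + lr x = x"
proof -
  have "x = (p + q) \<cdot> x \<cdot> (p + q)" by (simp add: unit_left unit_right)
  also have "\<dots> = p \<cdot> x \<cdot> p + q \<cdot> x \<cdot> p + (p \<cdot> x \<cdot> q + q \<cdot> x \<cdot> q)"
    by (simp only: distrib)
  finally show ?thesis
    using lower_zero[OF assms] by (simp add: ul_def ur_def lr_def add.assoc)
qed

text \<open>Every identity below is proved block by block; inside the blocks only the products
\<open>ul x \<cdot> ur y\<close>, \<open>ur x \<cdot> lr y\<close> and those of two equal diagonal blocks survive.\<close>

lemma eq_parts: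
  assumes "x \<in> A" "y \<in> A" "ul x = ul y" "ur x = ur y" "lr x = lr y"
  shows "x = y"
  by (metis assms parts_sum)

lemma parts_mult [simp]:
  assumes "x \<in> A" "y \<in> A"
  shows "ul (x \<cdot> y) = ul x \<cdot> ul y"
    and "ur (x \<cdot> y) = ul x \<cdot> ur y + ur x \<cdot> lr y"
    and "lr (x \<cdot> y) = lr x \<cdot> lr y"
proof -
  have prod: "x \<cdot> y = ul x \<cdot> ul y + (ul x \<cdot> ur y + ur x \<cdot> lr y) + lr x \<cdot> lr y"
    by (subst (1 2) parts_sum[symmetric]) (simp_all add: assms distrib)
  show "ul (x \<cdot> y) = ul x \<cdot> ul y"
    "ur (x \<cdot> y) = ul x \<cdot> ur y + ur x \<cdot> lr y"
    "lr (x \<cdot> y) = lr x \<cdot> lr y"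
    unfolding prod
    by (simp_all add: ul_def ur_def lr_def assoc pp qq pq qp absorb distrib)
qed

lemma ul_faithful:
  assumes "x \<in> A" "\<And>a. a \<in> A \<Longrightarrow> ul x \<cdot> ur a = 0" shows "ul x = 0"
  using faithful_left[OF assms(1)] assms(2) by (simp add: ul_def ur_def)

lemma lr_faithful:
  assumes "x \<in> A" "\<And>a. a \<in> A \<Longrightarrow> ur a \<cdot> lr x = 0" shows "lr x = 0"
  using faithful_right[OF assms(1)] assms(2) by (simp add: lr_def ur_def)

definition jordan where "jordan x y = x \<cdot> y + y \<cdot> x"

lemma jordan_commute: "jordan x y = jordan y x" by (simp add: jordan_def)

lemma jordan_closed [simp, intro]: "x \<in> A \<Longrightarrow> y \<in> A \<Longrightarrow> jordan x y \<in> A" by (simp add: jordan_def)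

lemma jordan_linear:
  "jordan (x + y) z = jordan x z + jordan y z" "jordan x (y + z) = jordan x y + jordan x z"
  "jordan (x - y) z = jordan x z - jordan y z" "jordan x (y - z) = jordan x y - jordan x z"
  "jordan (r *\<^sub>R x) y = r *\<^sub>R jordan x y" "jordan x (r *\<^sub>R y) = r *\<^sub>R jordan x y"
  "jordan x 0 = 0" "jordan 0 x = 0"
  by (simp_all add: jordan_def distrib algebra_simps)

definition unit where "unit = p + q"

lemma unit_closed [simp, intro]: "unit \<in> A" and unit_mult [simp]: "unit \<cdot> x = x" "x \<cdot> unit = x"
  and unit_parts [simp]: "ul unit = p" "ur unit = 0" "lr unit = q"
  by (simp_all add: unit_def unit_left unit_right)

lemma jordan_unit [simp]: "jordan x unit = 2 *\<^sub>R x" "jordan unit x = 2 *\<^sub>R x"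
  by (simp_all add: jordan_def scaleR_2)

lemma jordan_parts:
  assumes "x \<in> A" "y \<in> A"
  shows "ul (jordan x y) = ul x \<cdot> ul y + ul y \<cdot> ul x"
    and "ur (jordan x y) = ul x \<cdot> ur y + ur x \<cdot> lr y + ul y \<cdot> ur x + ur y \<cdot> lr x"
    and "lr (jordan x y) = lr x \<cdot> lr y + lr y \<cdot> lr x"
  using assms by (simp_all add: jordan_def)

text \<open>Reversing the multiplication and exchanging the idempotents exchanges the diagonal blocks.  The
Jordan product is unchanged, so statements about one diagonal block yield the other one.\<close>

lemma opposite: "triangular_algebra (\<lambda>x y. y \<cdot> x) A q p"
proof
  show "q \<cdot> (x \<cdot> q) = 0" if "x \<in> A" "\<And>a. a \<in> A \<Longrightarrow> p \<cdot> (a \<cdot> q) \<cdot> (q \<cdot> (x \<cdot> q)) = 0" for x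
    using faithful_right[OF that(1)] that(2) by (simp add: assoc)
  show "p \<cdot> (x \<cdot> p) = 0" if "x \<in> A" "\<And>a. a \<in> A \<Longrightarrow> p \<cdot> (x \<cdot> p) \<cdot> (p \<cdot> (a \<cdot> q)) = 0" for x
    using faithful_left[OF that(1)] that(2) by (simp add: assoc)
  show "q \<cdot> (x \<cdot> p) = 0" if "x \<in> A" for x
    using lower_zero[OF that] by (simp add: assoc)
  show "x \<cdot> (q + p) = x" "(q + p) \<cdot> x = x" for x
    by (simp_all add: add.commute[of q] unit_left unit_right)
qed (simp_all add: distrib subspace_A pp qq pq qp assoc)

end

section \<open>The Leibniz rule for iterated Jordan products\<close>

text \<open>For an additive \<open>f\<close>, this is the formal derivative of \<open>foldl f x ys\<close>: the sum over all positions of the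
iterated product with \<open>d\<close> applied at that position, except that the first entry contributes the
prescribed value \<open>v\<close>.  The recursion carries the pair of the derivative and the product along the
list, which turns the evaluation on constant lists into an induction.\<close>

primrec leibniz_fold :: "('a \<Rightarrow> 'a \<Rightarrow> 'a) \<Rightarrow> ('a \<Rightarrow> 'a) \<Rightarrow> 'a::plus \<Rightarrow> 'a \<Rightarrow> 'a list \<Rightarrow> 'a" where
  "leibniz_fold f d v x [] = v"
| "leibniz_fold f d v x (y # ys) = leibniz_fold f d (f v y + f x (d y)) (f x y) ys"

text \<open>For the Jordan product \<open>f\<close>, the case \<open>E = d\<close> expresses a Jordan \<open>(m + 1)\<close>-derivation, the general case a generalized one.\<close>

definition leibniz_on :: "('a::plus \<Rightarrow> 'a \<Rightarrow> 'a) \<Rightarrow> 'a set \<Rightarrow> nat \<Rightarrow> ('a \<Rightarrow> 'a) \<Rightarrow> ('a \<Rightarrow> 'a) \<Rightarrow> bool" where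
  "leibniz_on f A m E d \<longleftrightarrow> E \<in> A \<rightarrow> A \<and> d \<in> A \<rightarrow> A \<and>
     (\<forall>x\<in>A. \<forall>ys. set ys \<subseteq> A \<longrightarrow> length ys = m \<longrightarrow>
        E (foldl f x ys) = leibniz_fold f d (E x) x ys)"

context triangular_algebra
begin

lemma foldl_units: "foldl jordan x (replicate m unit) = 2 ^ m *\<^sub>R x"
  by (induction m arbitrary: x) (simp_all)

lemma leibniz_fold_units:
  "leibniz_fold jordan d v x (replicate m unit) = 2 ^ m *\<^sub>R v + (real m * 2 ^ m / 2) *\<^sub>R jordan x (d unit)"
  by (induction m arbitrary: v x)
    (simp_all add: jordan_linear algebra_simps add_divide_distrib)

lemma foldl_p_ur: "foldl jordan (ur a) (replicate m p) = ur a"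
  by (induction m) (simp_all add: jordan_def)

text \<open>Jordan multiplication by \<open>p\<close> is diagonal for the block decomposition, with eigenvalue \<open>2\<close> on the upper
left block, \<open>1\<close> on the corner and \<open>0\<close> on the lower right block.  The same eigenvalues
govern the evaluation on lists of \<open>p\<close> here and in the analogous lemma below.\<close>

lemma leibniz_fold_p_ur:
  assumes "v \<in> A" "a \<in> A" "d p \<in> A"
  assumes w_def: "w = leibniz_fold jordan d v (ur a) (replicate m p)"
  shows "ul w = 2 ^ m *\<^sub>R ul v" "ur w = ur v + real m *\<^sub>R ur (jordan (ur a) (d p))"
    "lr w = (if m = 0 then lr v else 0)"
proof -
  have [simp]: "jordan (ur a) p = ur a" by (simp add: jordan_def)
  have "ul w = 2 ^ m *\<^sub>R ul v \<and> ur w = ur v + real m *\<^sub>R ur (jordan (ur a) (d p)) \<and>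
    lr w = (if m = 0 then lr v else 0)"
    unfolding w_def using \<open>v \<in> A\<close>
  proof (induction m arbitrary: v)
    case (Suc m)
    show ?case
      using Suc.IH[of "jordan v p + jordan (ur a) (d p)"] Suc.prems assms(2,3)
      by (simp add: jordan_parts algebra_simps scaleR_double)
  qed simp
  then show "ul w = 2 ^ m *\<^sub>R ul v" "ur w = ur v + real m *\<^sub>R ur (jordan (ur a) (d p))"
    "lr w = (if m = 0 then lr v else 0)" by auto
qed

lemma foldl_p: "foldl jordan (c *\<^sub>R p) (replicate m p) = (2 ^ m * c) *\<^sub>R p"
  by (induction m arbitrary: c) (simp_all add: jordan_def distrib pp mult.commute flip: scaleR_2)

text \<open>As \<open>p \<circ> p = 2 p\<close>, the running product doubles at each step; the scalar \<open>c\<close> absorbs this in the induction.\<close>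

lemma leibniz_fold_p:
  assumes "v \<in> A" "d p \<in> A"
  assumes w_def: "w = leibniz_fold jordan d v (c *\<^sub>R p) (replicate m p)"
  shows "ul w = 2 ^ m *\<^sub>R ul v + (c * real m * 2 ^ m) *\<^sub>R ul (d p)"
    "ur w = ur v + (c * (2 ^ m - 1)) *\<^sub>R ur (d p)"
    "lr w = (if m = 0 then lr v else 0)"
proof -
  have [simp]: "jordan (c *\<^sub>R p) p = (2 * c) *\<^sub>R p" for c
    by (simp add: jordan_def distrib pp flip: scaleR_2)
  have "ul w = 2 ^ m *\<^sub>R ul v + (c * real m * 2 ^ m) *\<^sub>R ul (d p) \<and>
    ur w = ur v + (c * (2 ^ m - 1)) *\<^sub>R ur (d p) \<and> lr w = (if m = 0 then lr v else 0)"
    unfolding w_def using \<open>v \<in> A\<close>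
  proof (induction m arbitrary: v c)
    case (Suc m)
    show ?case
      using Suc.IH[of "jordan v p + jordan (c *\<^sub>R p) (d p)" "2 * c"] Suc.prems assms(2)
      by (simp add: jordan_parts distrib algebra_simps scaleR_double)
  qed simp
  then show "ul w = 2 ^ m *\<^sub>R ul v + (c * real m * 2 ^ m) *\<^sub>R ul (d p)"
    "ur w = ur v + (c * (2 ^ m - 1)) *\<^sub>R ur (d p)"
    "lr w = (if m = 0 then lr v else 0)" by auto
qed

text \<open>The element \<open>2\<^sup>m p\<close> is the iterated product of \<open>p\<close> with units as well as with copies of \<open>p\<close>.
Comparing the two values of \<open>D\<close> in the lower right block gives \<open>lr (D p) = 0\<close>; then the product of a
corner element with copies of \<open>p\<close> shows that \<open>ul (D p)\<close> annihilates the corner.  The other blocks of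
the comparison determine \<open>D unit\<close>.\<close>

lemma leibniz_at_p:
  assumes D: "leibniz_on jordan A m D D" and m: "m \<ge> 1"
  shows "ul (D p) = 0" "lr (D p) = 0" "ul (D unit) = 0" "ur (D unit) = 0"
proof -
  have DA [simp]: "D x \<in> A" if "x \<in> A" for x using D that by (auto simp: leibniz_on_def)
  have L: "D (foldl jordan x (replicate m y)) = leibniz_fold jordan D (D x) x (replicate m y)"
    if "x \<in> A" "y \<in> A" for x y
    using D that by (auto simp: leibniz_on_def set_replicate_conv_if)
  have m0: "m \<noteq> 0" using m by simp
  have two: "2 ^ m *\<^sub>R D p + (real m * 2 ^ m / 2) *\<^sub>R jordan p (D unit) =
      leibniz_fold jordan D (D p) (1 *\<^sub>R p) (replicate m p)"
    using L[of p unit] L[of p p] foldl_p[of 1 m] by (simp add: foldl_units leibniz_fold_units)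
  note parts = leibniz_fold_p[OF _ _ two, simplified]
  show lrp: "lr (D p) = 0"
    using parts(3) m0 by (simp add: jordan_parts)
  show ulp: "ul (D p) = 0"
  proof (rule ul_faithful)
    fix a assume a: "a \<in> A"
    have "ur (D (ur a)) = ur (D (ur a)) + real m *\<^sub>R ur (jordan (ur a) (D p))"
      using L[of "ur a" p] leibniz_fold_p_ur(2)[OF _ _ _ refl, of "D (ur a)" a D m] a by (simp add: foldl_p_ur)
    then show "ul (D p) \<cdot> ur a = 0"
      using m0 a lrp by (simp add: jordan_parts distrib)
  qed simp
  show "ul (D unit) = 0"
    using parts(1) m0 ulp by (simp add: jordan_parts flip: scaleR_2)
  show "ur (D unit) = 0"
    using parts(2) m0 by (simp add: jordan_parts algebra_simps)
qed

section \<open>Multiplicative Jordan derivations\<close>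

lemma opposite_jordan: "triangular_algebra.jordan (\<lambda>x y. y \<cdot> x) = jordan"
  by (intro ext) (simp add: triangular_algebra.jordan_def[OF opposite] jordan_def add.commute)

lemma leibniz_unit:
  assumes D: "leibniz_on jordan A m D D" and m: "m \<ge> 1"
  shows "D unit = 0"
proof -
  interpret op: triangular_algebra "\<lambda>x y. y \<cdot> x" A q p by (rule opposite)
  have [simp]: "op.unit = unit" by (simp add: op.unit_def unit_def add.commute)
  have lr0: "q \<cdot> (D unit \<cdot> q) = 0"
    using op.leibniz_at_p(3)[unfolded opposite_jordan, OF D m] by (simp add: op.ul_def)
  have "D unit \<in> A" using D by (auto simp: leibniz_on_def)
  then show ?thesis
    by - (rule eq_parts; use leibniz_at_p(3,4)[OF D m] lr0 in \<open>simp add: lr_def assoc\<close>)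
qed

text \<open>A list of units after the first one or two entries contributes only a power of \<open>2\<close>, since \<open>d\<close>
vanishes at the unit.\<close>

lemma leibniz_on_with_units:
  assumes E: "leibniz_on jordan A m E d" and du: "d unit = 0" and "x \<in> A"
  shows "E (2 ^ m *\<^sub>R x) = 2 ^ m *\<^sub>R E x"
    and "y \<in> A \<Longrightarrow> m = Suc k \<Longrightarrow> E (2 ^ k *\<^sub>R jordan x y) = 2 ^ k *\<^sub>R (jordan (E x) y + jordan x (d y))"
proof -
  have L: "E (foldl jordan x ys) = leibniz_fold jordan d (E x) x ys" if "set ys \<subseteq> A" "length ys = m" for ys
    using E that \<open>x \<in> A\<close> by (auto simp: leibniz_on_def)
  show "E (2 ^ m *\<^sub>R x) = 2 ^ m *\<^sub>R E x"
    using L[of "replicate m unit"]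
    by (simp add: set_replicate_conv_if foldl_units leibniz_fold_units du jordan_linear)
  show "E (2 ^ k *\<^sub>R jordan x y) = 2 ^ k *\<^sub>R (jordan (E x) y + jordan x (d y))" if "y \<in> A" "m = Suc k"
    using L[of "y # replicate k unit"] that
    by (simp add: set_replicate_conv_if foldl_units leibniz_fold_units du jordan_linear)
qed

text \<open>The two identities obtained from units combine to \<open>D ((x \<circ> y) / 2) = (D x \<circ> y + x \<circ> D y) / 2\<close>.
This still allows \<open>D\<close> to behave on powers of \<open>2\<close> like a logarithmic derivative,
\<open>D (2\<^sup>j) = j 2\<^sup>j\<^sup>-\<^sup>1 D 2\<close>.  As \<open>D\<close> vanishes at \<open>2\<^sup>m\<close> and \<open>m > 0\<close>, it vanishes at \<open>2\<close>, hence
commutes with doubling.\<close>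

lemma leibniz_binary:
  assumes D: "leibniz_on jordan A m D D" and m: "m \<ge> 1" and xy: "x \<in> A" "y \<in> A"
  shows "D (jordan x y) = jordan (D x) y + jordan x (D y)"
proof -
  have DA [simp]: "D x \<in> A" if "x \<in> A" for x using D that by (auto simp: leibniz_on_def)
  note du = leibniz_unit[OF D m]
  obtain k where k: "m = Suc k" using m by (cases m) auto
  have half: "D ((1/2) *\<^sub>R jordan x y) = (1/2) *\<^sub>R (jordan (D x) y + jordan x (D y))" if "x \<in> A" "y \<in> A" for x y
  proof -
    have "2 ^ m *\<^sub>R D ((1/2) *\<^sub>R jordan x y) = D (2 ^ m *\<^sub>R (1/2) *\<^sub>R jordan x y)"
      by (rule leibniz_on_with_units(1)[OF D du, symmetric]) (use that in auto)
    also have "\<dots> = D (2 ^ k *\<^sub>R jordan x y)" by (simp add: k)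
    also have "\<dots> = 2 ^ m *\<^sub>R (1/2) *\<^sub>R (jordan (D x) y + jordan x (D y))"
      using leibniz_on_with_units(2)[OF D du that k] by (simp add: k)
    finally show ?thesis by (simp only: scaleR_cancel_left) simp
  qed
  have powers: "D (2 ^ Suc j *\<^sub>R unit) = (real (Suc j) * 2 ^ j) *\<^sub>R D (2 *\<^sub>R unit)" for j
  proof (induction j)
    case (Suc j)
    have "2 ^ Suc (Suc j) *\<^sub>R unit = (1/2) *\<^sub>R jordan (2 ^ Suc j *\<^sub>R unit) (2 *\<^sub>R unit)"
      by (simp add: jordan_linear)
    then have "D (2 ^ Suc (Suc j) *\<^sub>R unit) =
        (1/2) *\<^sub>R (jordan (D (2 ^ Suc j *\<^sub>R unit)) (2 *\<^sub>R unit) + jordan (2 ^ Suc j *\<^sub>R unit) (D (2 *\<^sub>R unit)))"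
      using half by simp
    also have "\<dots> = 2 *\<^sub>R D (2 ^ Suc j *\<^sub>R unit) + 2 ^ Suc j *\<^sub>R D (2 *\<^sub>R unit)"
      by (simp add: jordan_linear scaleR_add_right)
    finally show ?case unfolding Suc.IH
      by (simp add: algebra_simps flip: scaleR_left_distrib)
  qed simp
  have "D (2 ^ Suc k *\<^sub>R unit) = 0"
    using leibniz_on_with_units(1)[OF D du unit_closed] by (simp add: k du)
  then have two: "D (2 *\<^sub>R unit) = 0" using powers[of k] by simp
  have double: "D (2 *\<^sub>R z) = 2 *\<^sub>R D z" if "z \<in> A" for z
    using half[of z "2 *\<^sub>R unit"] that two by (simp add: jordan_linear)
  have "D (jordan x y) = 2 *\<^sub>R D ((1/2) *\<^sub>R jordan x y)"
    using double[of "(1/2) *\<^sub>R jordan x y"] xy by simp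
  also have "\<dots> = jordan (D x) y + jordan x (D y)" unfolding half[OF xy] by simp
  finally show ?thesis .
qed

text \<open>Since \<open>D\<close> vanishes at \<open>p\<close> and \<open>q\<close>, it commutes with Jordan multiplication by either, hence preserves
their eigenspaces, the blocks.  Additivity is established first on the corner and then
transported to the diagonal blocks through their faithful action on it.\<close>

lemma jordan_derivation_vanishing_at_p:
  assumes DA [simp]: "\<And>x. x \<in> A \<Longrightarrow> D x \<in> A"
    and D: "\<And>x y. x \<in> A \<Longrightarrow> y \<in> A \<Longrightarrow> D (jordan x y) = jordan (D x) y + jordan x (D y)"
    and Du: "D unit = 0" and Dp: "D p = 0"
    and "x \<in> A" "y \<in> A"
  shows "D (x + y) = D x + D y" and "D (x \<cdot> y) = D x \<cdot> y + x \<cdot> D y"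
proof -
  have D0: "D 0 = 0" using D[of 0 0] by (simp add: jordan_linear)
  have double: "D (2 *\<^sub>R z) = 2 *\<^sub>R D z" if "z \<in> A" for z
    using D[of z unit] that by (simp add: Du jordan_linear)
  have Jpq [simp]: "jordan p p = 2 *\<^sub>R p" "jordan q q = 2 *\<^sub>R q" "jordan p q = 0" "jordan q p = 0"
    "jordan (ur a) p = ur a" "jordan q (ur a) = ur a" "jordan p (ur a) = ur a" "jordan (ur a) q = ur a" "jordan (ur a) (ur b) = 0"
    for a b by (simp_all add: jordan_def pp qq pq qp scaleR_2)
  have Dq: "D q = 0"
  proof (rule eq_parts)
    have e: "jordan p (D q) = 0" using D[of p q] by (simp add: D0 Dp jordan_linear)
    show "ul (D q) = ul 0" "ur (D q) = ur 0"
      using arg_cong[OF e, of ul] arg_cong[OF e, of ur] by (simp_all add: jordan_parts flip: scaleR_2)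
    have e: "2 *\<^sub>R D q = jordan (D q) q + jordan q (D q)" using D[of q q] double[of q] by simp
    show "lr (D q) = lr 0"
      using arg_cong[OF e, of lr] by (simp add: jordan_parts flip: scaleR_2)
  qed simp_all
  have Jp: "D (jordan p x) = jordan p (D x)" and Jq: "D (jordan q x) = jordan q (D x)" if "x \<in> A" for x
    using D[of p x] D[of q x] that by (simp_all add: Dp Dq jordan_linear)
  have parts_D: "ul (D (ur z)) = 0" "ur (D (ur z)) = ur (D z)" "lr (D (ur z)) = 0"
    "ur (D (ul z)) = 0" "lr (D (ul z)) = 0" "ul (D (lr z)) = 0" "ur (D (lr z)) = 0"
    if z: "z \<in> A" for z
  proof -
    have "jordan q (jordan p z) = ur z"
      by (rule eq_parts) (simp_all add: z jordan_parts)
    then have e: "D (ur z) = jordan q (jordan p (D z))"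
      using Jq[of "jordan p z"] Jp[OF z] z by simp
    show "ul (D (ur z)) = 0" "ur (D (ur z)) = ur (D z)" "lr (D (ur z)) = 0"
      unfolding e using z by (simp_all add: jordan_parts)
    have e: "jordan q (D (ul z)) = 0" using Jq[of "ul z"] z D0 by (simp add: jordan_def)
    show "ur (D (ul z)) = 0" "lr (D (ul z)) = 0"
      using arg_cong[OF e, of ur] arg_cong[OF e, of lr] z by (simp_all add: jordan_parts flip: scaleR_2)
    have e: "jordan p (D (lr z)) = 0" using Jp[of "lr z"] z D0 by (simp add: jordan_def)
    show "ur (D (lr z)) = 0" "ul (D (lr z)) = 0"
      using arg_cong[OF e, of ur] arg_cong[OF e, of ul] z by (simp_all add: jordan_parts flip: scaleR_2)
  qed
  have D_ur: "D (ur z) = ur (D z)" and D_ul: "D (ul z) = ul (D (ul z))"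
    and D_lr: "D (lr z) = lr (D (lr z))" if z: "z \<in> A" for z
    by (rule eq_parts; use z parts_D[OF z] in simp)+
  \<comment> \<open>For \<open>a\<close> in the corner, the Jordan product with \<open>q\<close> controls all blocks of \<open>D (p + a)\<close> but the upper left one, which vanishes since \<open>p + a\<close> is idempotent; likewise for \<open>a + q\<close> and \<open>p\<close>.\<close>
  have D_p_ur: "D (p + ur z) = ur (D z)" and D_ur_q: "D (ur z + q) = ur (D z)" if z: "z \<in> A" for z
  proof -
    have e: "D (p + ur z) = jordan (D (p + ur z)) (p + ur z)"
    proof -
      have "jordan (p + ur z) (p + ur z) = 2 *\<^sub>R (p + ur z)"
        by (simp add: jordan_linear scaleR_2)
      then have "2 *\<^sub>R D (p + ur z) = 2 *\<^sub>R jordan (D (p + ur z)) (p + ur z)"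
        using D[of "p + ur z" "p + ur z"] double[of "p + ur z"] z
        by (simp add: jordan_commute[of "p + ur z" "D _"] scaleR_2)
      then show ?thesis by simp
    qed
    have "jordan q (p + ur z) = ur z"
      by (simp add: jordan_linear)
    then have e': "D (ur z) = jordan q (D (p + ur z))"
      using Jq[of "p + ur z"] z by simp
    show "D (p + ur z) = ur (D z)"
    proof (rule eq_parts)
      show "ul (D (p + ur z)) = ul (ur (D z))"
        using arg_cong[OF e, of ul] z by (simp add: jordan_parts)
      show "ur (D (p + ur z)) = ur (ur (D z))" "lr (D (p + ur z)) = lr (ur (D z))"
        using arg_cong[OF e', of ur] arg_cong[OF e', of lr] z parts_D[OF z]
        by (simp_all add: jordan_parts flip: scaleR_2)
    qed (use z in simp_all)
    have e: "D (ur z + q) = jordan (D (ur z + q)) (ur z + q)"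
    proof -
      have "jordan (ur z + q) (ur z + q) = 2 *\<^sub>R (ur z + q)"
        by (simp add: jordan_linear scaleR_2)
      then have "2 *\<^sub>R D (ur z + q) = 2 *\<^sub>R jordan (D (ur z + q)) (ur z + q)"
        using D[of "ur z + q" "ur z + q"] double[of "ur z + q"] z
        by (simp add: jordan_commute[of "ur z + q" "D _"] scaleR_2)
      then show ?thesis by simp
    qed
    have "jordan p (ur z + q) = ur z"
      by (simp add: jordan_linear)
    then have e': "D (ur z) = jordan p (D (ur z + q))"
      using Jp[of "ur z + q"] z by simp
    show "D (ur z + q) = ur (D z)"
    proof (rule eq_parts)
      show "lr (D (ur z + q)) = lr (ur (D z))"
        using arg_cong[OF e, of lr] z by (simp add: jordan_parts)
      show "ur (D (ur z + q)) = ur (ur (D z))" "ul (D (ur z + q)) = ul (ur (D z))"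
        using arg_cong[OF e', of ur] arg_cong[OF e', of ul] z parts_D[OF z]
        by (simp_all add: jordan_parts flip: scaleR_2)
    qed (use z in simp_all)
  qed
  have D_ur_add: "D (ur a + ur b) = D (ur a) + D (ur b)" if "a \<in> A" "b \<in> A" for a b
  proof -
    \<comment> \<open>Only \<open>p \<circ> ur a\<close> and \<open>ur b \<circ> q\<close> survive, so a sum in the corner is a single Jordan product.\<close>
    have "ur a + ur b = jordan (p + ur b) (ur a + q)"
      by (simp add: jordan_linear)
    then show ?thesis
      using D[of "p + ur b" "ur a + q"] that D_p_ur[of b] D_ur_q[of a] D_ur[of a] D_ur[of b]
      by (simp add: jordan_linear jordan_commute[of "ur (D a)"])
  qed
  have D_left: "D (ul z \<cdot> ur a) = D (ul z) \<cdot> ur a + ul z \<cdot> D (ur a)"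
    and D_right: "D (ur a \<cdot> lr z) = D (ur a) \<cdot> lr z + ur a \<cdot> D (lr z)" if "z \<in> A" "a \<in> A" for z a
  proof -
    have "ur a \<cdot> D (ul z) = 0" "D (ur a) \<cdot> ul z = 0" "D (lr z) \<cdot> ur a = 0" "lr z \<cdot> D (ur a) = 0"
      by (subst D_ur D_ul D_lr, use that in simp_all)+
    then show "D (ul z \<cdot> ur a) = D (ul z) \<cdot> ur a + ul z \<cdot> D (ur a)"
      "D (ur a \<cdot> lr z) = D (ur a) \<cdot> lr z + ur a \<cdot> D (lr z)"
      using D[of "ul z" "ur a"] D[of "ur a" "lr z"] that by (simp_all add: jordan_def)
  qed
  have ul_cancel: "ul b = ul c" if "b \<in> A" "c \<in> A" "\<And>a. a \<in> A \<Longrightarrow> ul b \<cdot> ur a = ul c \<cdot> ur a" for b c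
    using ul_faithful[of "b - c"] that by (simp add: distrib)
  have lr_cancel: "lr b = lr c" if "b \<in> A" "c \<in> A" "\<And>a. a \<in> A \<Longrightarrow> ur a \<cdot> lr b = ur a \<cdot> lr c" for b c
    using lr_faithful[of "b - c"] that by (simp add: distrib)
  have ul_D: "ul (D z) = D (ul z)" and lr_D: "lr (D z) = D (lr z)" if z: "z \<in> A" for z
  proof -
    have e: "D (jordan p z) = jordan p (D z)" "D (jordan q z) = jordan q (D z)" using Jp Jq z by auto
    \<comment> \<open>\<open>jordan p z\<close> has no lower right block, and neither has its image; multiplying by the corner therefore compares the upper left blocks alone.\<close>
    have "ul (D (jordan p z)) = ul (D (ul (jordan p z)))"
    proof (rule ul_cancel)
      fix a assume a: "a \<in> A"
      have "jordan (jordan p z) (ur a) = ul (jordan p z) \<cdot> ur a"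
        by (rule eq_parts) (use z a in \<open>simp_all add: jordan_parts distrib\<close>)
      then have "D (ul (jordan p z) \<cdot> ur a) = jordan (D (jordan p z)) (ur a) + jordan (jordan p z) (D (ur a))"
        using D[of "jordan p z" "ur a"] z a by simp
      then have "ur (D (ul (jordan p z)) \<cdot> ur a + ul (jordan p z) \<cdot> D (ur a)) =
          ur (jordan (jordan p (D z)) (ur a) + jordan (jordan p z) (D (ur a)))"
        using D_left[of "jordan p z" a] z a e by simp
      then show "ul (D (jordan p z)) \<cdot> ur a = ul (D (ul (jordan p z))) \<cdot> ur a"
        using z a parts_D[OF a] by (simp add: jordan_parts e distrib)
    qed (use z in simp_all)
    then show "ul (D z) = D (ul z)"
      using z D_ul[of z] double[of "ul z"] by (simp add: e jordan_parts flip: scaleR_2)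
    have "lr (D (jordan q z)) = lr (D (lr (jordan q z)))"
    proof (rule lr_cancel)
      fix a assume a: "a \<in> A"
      have "jordan (ur a) (jordan q z) = ur a \<cdot> lr (jordan q z)"
        by (rule eq_parts) (use z a in \<open>simp_all add: jordan_parts distrib\<close>)
      then have "D (ur a \<cdot> lr (jordan q z)) = jordan (D (ur a)) (jordan q z) + jordan (ur a) (D (jordan q z))"
        using D[of "ur a" "jordan q z"] z a by simp
      then have "ur (D (ur a) \<cdot> lr (jordan q z) + ur a \<cdot> D (lr (jordan q z))) =
          ur (jordan (D (ur a)) (jordan q z) + jordan (ur a) (jordan q (D z)))"
        using D_right[of "jordan q z" a] z a e by simp
      then show "ur a \<cdot> lr (D (jordan q z)) = ur a \<cdot> lr (D (lr (jordan q z)))"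
        using z a parts_D[OF a] by (simp add: jordan_parts e distrib)
    qed (use z in simp_all)
    then show "lr (D z) = D (lr z)"
      using z D_lr[of z] double[of "lr z"] by (simp add: e jordan_parts flip: scaleR_2)
  qed
  \<comment> \<open>Additivity on the corner, applied to \<open>ul a \<cdot> ur c\<close> and \<open>ul b \<cdot> ur c\<close>, becomes additivity on the diagonal because \<open>c\<close> is arbitrary.\<close>
  have D_ul_add: "D (ul a + ul b) = D (ul a) + D (ul b)"
    and D_lr_add: "D (lr a + lr b) = D (lr a) + D (lr b)" if ab: "a \<in> A" "b \<in> A" for a b
  proof -
    have "ul (D (ul a + ul b)) = ul (D (ul a) + D (ul b))"
    proof (rule ul_cancel)
      fix c assume c: "c \<in> A"
      have "D (ul (a + b) \<cdot> ur c) = D (ul a \<cdot> ur c) + D (ul b \<cdot> ur c)"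
        using D_ur_add[of "ul a \<cdot> ur c" "ul b \<cdot> ur c"] ab c by (simp add: distrib)
      then show "ul (D (ul a + ul b)) \<cdot> ur c = ul (D (ul a) + D (ul b)) \<cdot> ur c"
        using D_left[of "a + b" c] D_left[of a c] D_left[of b c] ab c ul_D[of "ul a + ul b"]
        by (simp add: distrib ul_D algebra_simps)
    qed (use ab in simp_all)
    then show "D (ul a + ul b) = D (ul a) + D (ul b)"
      using ab by (simp add: ul_D)
    have "lr (D (lr a + lr b)) = lr (D (lr a) + D (lr b))"
    proof (rule lr_cancel)
      fix c assume c: "c \<in> A"
      have "D (ur c \<cdot> lr (a + b)) = D (ur c \<cdot> lr a) + D (ur c \<cdot> lr b)"
        using D_ur_add[of "ur c \<cdot> lr a" "ur c \<cdot> lr b"] ab c by (simp add: distrib)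
      then show "ur c \<cdot> lr (D (lr a + lr b)) = ur c \<cdot> lr (D (lr a) + D (lr b))"
        using D_right[of "a + b" c] D_right[of a c] D_right[of b c] ab c lr_D[of "lr a + lr b"]
        by (simp add: distrib lr_D algebra_simps)
    qed (use ab in simp_all)
    then show "D (lr a + lr b) = D (lr a) + D (lr b)"
      using ab by (simp add: lr_D)
  qed
  \<comment> \<open>Expand \<open>D\<close> of \<open>ul x \<cdot> ul y \<cdot> ur c\<close> with both groupings and cancel \<open>c\<close>.\<close>
  have D_ul_mult: "D (ul x \<cdot> ul y) = D (ul x) \<cdot> ul y + ul x \<cdot> D (ul y)"
  proof -
    have "ul (D (ul x \<cdot> ul y)) = ul (D (ul x) \<cdot> ul y + ul x \<cdot> D (ul y))"
    proof (rule ul_cancel)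
      fix c assume c: "c \<in> A"
      have "D (ul (x \<cdot> y) \<cdot> ur c) = D (ul x \<cdot> ur (ul y \<cdot> ur c))"
        using \<open>x \<in> A\<close> \<open>y \<in> A\<close> c by (simp add: assoc)
      then show "ul (D (ul x \<cdot> ul y)) \<cdot> ur c = ul (D (ul x) \<cdot> ul y + ul x \<cdot> D (ul y)) \<cdot> ur c"
        using D_left[of "x \<cdot> y" c] D_left[of x "ul y \<cdot> ur c"] D_left[of y c] \<open>x \<in> A\<close> \<open>y \<in> A\<close> c
        by (simp add: distrib ul_D assoc)
    qed (use \<open>x \<in> A\<close> \<open>y \<in> A\<close> in simp_all)
    then show ?thesis using \<open>x \<in> A\<close> \<open>y \<in> A\<close> by (simp add: ul_D)
  qed
  have D_lr_mult: "D (lr x \<cdot> lr y) = D (lr x) \<cdot> lr y + lr x \<cdot> D (lr y)"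
  proof -
    have "lr (D (lr x \<cdot> lr y)) = lr (D (lr x) \<cdot> lr y + lr x \<cdot> D (lr y))"
    proof (rule lr_cancel)
      fix c assume c: "c \<in> A"
      have "D (ur c \<cdot> lr (x \<cdot> y)) = D (ur (ur c \<cdot> lr x) \<cdot> lr y)"
        using \<open>x \<in> A\<close> \<open>y \<in> A\<close> c by (simp add: assoc)
      then show "ur c \<cdot> lr (D (lr x \<cdot> lr y)) = ur c \<cdot> lr (D (lr x) \<cdot> lr y + lr x \<cdot> D (lr y))"
        using D_right[of "x \<cdot> y" c] D_right[of y "ur c \<cdot> lr x"] D_right[of x c] \<open>x \<in> A\<close> \<open>y \<in> A\<close> c
        by (simp add: distrib lr_D assoc)
    qed (use \<open>x \<in> A\<close> \<open>y \<in> A\<close> in simp_all)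
    then show ?thesis using \<open>x \<in> A\<close> \<open>y \<in> A\<close> by (simp add: lr_D)
  qed
  have ur_D: "ur (D z) = D (ur z)" if "z \<in> A" for z
    using D_ur[OF that] by simp
  show "D (x + y) = D x + D y"
    by (rule eq_parts) (use \<open>x \<in> A\<close> \<open>y \<in> A\<close> in \<open>simp_all add: ul_D ur_D lr_D D_ul_add D_ur_add D_lr_add\<close>)
  show "D (x \<cdot> y) = D x \<cdot> y + x \<cdot> D y"
  proof (rule eq_parts)
    have "D (ul x \<cdot> ur y + ur x \<cdot> lr y) = D (ul x \<cdot> ur y) + D (ur x \<cdot> lr y)"
      using D_ur_add[of "ul x \<cdot> ur y" "ur x \<cdot> lr y"] \<open>x \<in> A\<close> \<open>y \<in> A\<close> by simp
    then show "ur (D (x \<cdot> y)) = ur (D x \<cdot> y + x \<cdot> D y)"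
      using \<open>x \<in> A\<close> \<open>y \<in> A\<close> by (simp add: ur_D ul_D lr_D D_left D_right algebra_simps)
  qed (use \<open>x \<in> A\<close> \<open>y \<in> A\<close> in \<open>simp_all add: ul_D lr_D D_ul_mult D_lr_mult\<close>)
qed

text \<open>As \<open>s = D p\<close> lies in the corner, the inner derivation \<open>x \<mapsto> x s - s x\<close> takes the value \<open>s\<close> at \<open>p\<close>.
Subtracting it reduces the claim to a Jordan derivation that vanishes at \<open>p\<close>.\<close>

lemma jordan_n_derivation_is_derivation:
  assumes D: "leibniz_on jordan A m D D" and m: "m \<ge> 1" and xy: "x \<in> A" "y \<in> A"
  shows "D (x + y) = D x + D y" and "D (x \<cdot> y) = D x \<cdot> y + x \<cdot> D y"
proof -
  have DA [simp]: "D x \<in> A" if "x \<in> A" for x using D that by (auto simp: leibniz_on_def)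
  define s where "s = D p"
  have [simp]: "s \<in> A" by (simp add: s_def)
  have s: "ur s = s"
    by (rule eq_parts; use leibniz_at_p(1,2)[OF D m] in \<open>simp add: s_def\<close>)
  define d where "d x = D x - (x \<cdot> s - s \<cdot> x)" for x
  have "d p = 0"
    using parts_products(5,8)[of s] by (simp add: d_def s s_def[symmetric])
  moreover have "d unit = 0" using leibniz_unit[OF D m] by (simp add: d_def)
  moreover have "d (jordan x y) = jordan (d x) y + jordan x (d y)" if "x \<in> A" "y \<in> A" for x y
    using leibniz_binary[OF D m that] by (simp add: d_def jordan_def distrib assoc algebra_simps)
  ultimately have "d (x + y) = d x + d y" "d (x \<cdot> y) = d x \<cdot> y + x \<cdot> d y"
    using jordan_derivation_vanishing_at_p[of d x y] xy by (simp_all add: d_def)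
  then show "D (x + y) = D x + D y" "D (x \<cdot> y) = D x \<cdot> y + x \<cdot> D y"
    by (simp_all add: d_def distrib assoc algebra_simps)
qed

text \<open>The hypothesis at \<open>x = y = p\<close> removes the corner of \<open>c\<close>; at \<open>x = p\<close> and \<open>y\<close> in the corner it says that
\<open>c\<close> commutes with the corner.  By faithfulness \<open>c\<close> then commutes with the diagonal blocks.\<close>

lemma central_of_jordan_associative:
  assumes c: "c \<in> A"
    and jordan: "\<And>x y. x \<in> A \<Longrightarrow> y \<in> A \<Longrightarrow> jordan c (jordan x y) = jordan (jordan c x) y"
    and x: "x \<in> A"
  shows "c \<cdot> x = x \<cdot> c"
proof -
  have urc: "ur c = 0"
  proof -
    have "jordan p p = 2 *\<^sub>R p" by (simp add: jordan_def pp scaleR_2)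
    then have "2 *\<^sub>R jordan c p = jordan (jordan c p) p" using jordan[of p p] by (simp add: jordan_linear)
    from arg_cong[OF this, of ur] show ?thesis
      using c by (simp add: jordan_parts scaleR_2)
  qed
  have comm: "ul c \<cdot> ur a = ur a \<cdot> lr c" if a: "a \<in> A" for a
  proof -
    have "jordan p (ur a) = ur a" "jordan (ur a) p = ur a" by (simp_all add: jordan_def)
    then have e: "jordan c (ur a) = jordan (jordan c p) (ur a)"
      using jordan[of p "ur a"] a by simp
    from arg_cong[OF e, of ur] show ?thesis
      using c a by (simp add: jordan_parts distrib)
  qed
  have "ul (c \<cdot> x) = ul (x \<cdot> c)"
  proof -
    have "ul (c \<cdot> x - x \<cdot> c) = 0"
    proof (rule ul_faithful)
      fix a assume a: "a \<in> A"
      have "ul c \<cdot> (ul x \<cdot> ur a) = ul x \<cdot> (ul c \<cdot> ur a)"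
        using comm[of "ul x \<cdot> ur a"] comm[of a] a x by (simp add: assoc)
      then show "ul (c \<cdot> x - x \<cdot> c) \<cdot> ur a = 0" using c x by (simp add: distrib assoc)
    qed (use c x in simp)
    then show ?thesis by simp
  qed
  moreover have "lr (c \<cdot> x) = lr (x \<cdot> c)"
  proof -
    have "lr (c \<cdot> x - x \<cdot> c) = 0"
    proof (rule lr_faithful)
      fix a assume a: "a \<in> A"
      have "(ur a \<cdot> lr x) \<cdot> lr c = (ur a \<cdot> lr c) \<cdot> lr x"
        using comm[of "ur a \<cdot> lr x"] comm[of a, symmetric] a x by (simp add: assoc flip: comm)
      then show "ur a \<cdot> lr (c \<cdot> x - x \<cdot> c) = 0" using c x by (simp add: distrib assoc)
    qed (use c x in simp)
    then show ?thesis by simp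
  qed
  moreover have "ur (c \<cdot> x) = ur (x \<cdot> c)"
    using comm[OF x] c x by (simp add: urc)
  ultimately show ?thesis using c x by (intro eq_parts[of "c \<cdot> x" "x \<cdot> c"]) simp_all
qed

text \<open>Units after the first entry, and units everywhere except in the second entry, give two values of
\<open>E (2\<^sup>m x)\<close>, whence \<open>E x = (c \<circ> x) / 2 + d x\<close> with \<open>c = E unit\<close>.  Inserting this into the binary identity
leaves the associativity law \<open>c \<circ> (x \<circ> y) = (c \<circ> x) \<circ> y\<close>.\<close>

theorem generalized_jordan_n_derivation:
  assumes E: "leibniz_on jordan A m E d" and d: "leibniz_on jordan A m d d" and m: "m \<ge> 1"
  obtains c where "c \<in> A" "\<And>x. x \<in> A \<Longrightarrow> c \<cdot> x = x \<cdot> c" "\<And>x. x \<in> A \<Longrightarrow> E x = c \<cdot> x + d x"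
proof -
  have A [simp]: "d x \<in> A" "E x \<in> A" if "x \<in> A" for x
    using E that by (auto simp: leibniz_on_def)
  note du = leibniz_unit[OF d m]
  obtain k where k: "m = Suc k" using m by (cases m) auto
  have EJ: "2 ^ k *\<^sub>R (jordan (E x) y + jordan x (d y)) = E (2 ^ k *\<^sub>R jordan x y)" if "x \<in> A" "y \<in> A" for x y
    using leibniz_on_with_units(2)[OF E du that k] by simp
  define c where "c = E unit"
  have c: "c \<in> A" by (simp add: c_def)
  have half: "E x = (1/2) *\<^sub>R jordan c x + d x" if x: "x \<in> A" for x
  proof -
    have "2 ^ k *\<^sub>R (jordan c x + 2 *\<^sub>R d x) = E (2 ^ m *\<^sub>R x)"
      using EJ[of unit x] x by (simp add: c_def k mult.commute)
    also have "\<dots> = 2 ^ k *\<^sub>R (2 *\<^sub>R E x)"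
      using leibniz_on_with_units(1)[OF E du x] by (simp add: k mult.commute)
    finally have "2 *\<^sub>R E x = jordan c x + 2 *\<^sub>R d x"
      by (simp only: scaleR_cancel_left) simp
    then have "(1/2) *\<^sub>R (2 *\<^sub>R E x) = (1/2) *\<^sub>R (jordan c x + 2 *\<^sub>R d x)" by simp
    then show ?thesis by (simp add: scaleR_add_right)
  qed
  have central: "c \<cdot> x = x \<cdot> c" if "x \<in> A" for x
  proof (rule central_of_jordan_associative[OF c _ that])
    fix x y assume xy: "x \<in> A" "y \<in> A"
    \<comment> \<open>Halving turns the factor \<open>2\<^sup>k\<close> of the binary identity into \<open>2\<^sup>m\<close>, with which \<open>E\<close> commutes.\<close>
    define w where "w = (1/2) *\<^sub>R jordan x y"
    have w: "w \<in> A" "jordan x y = 2 *\<^sub>R w" using xy by (simp_all add: w_def)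
    have "2 ^ k *\<^sub>R (jordan (E x) y + jordan x (d y)) = E (2 ^ m *\<^sub>R w)"
      using EJ[OF xy] w(2) by (simp add: k mult.commute)
    also have "\<dots> = 2 ^ k *\<^sub>R (2 *\<^sub>R E w)"
      using leibniz_on_with_units(1)[OF E du w(1)] by (simp add: k mult.commute)
    finally have e: "jordan (E x) y + jordan x (d y) = 2 *\<^sub>R E w"
      by (simp only: scaleR_cancel_left) simp
    have "d (jordan x y) = 2 *\<^sub>R d w"
      using jordan_n_derivation_is_derivation(1)[OF d m w(1) w(1)] w(2) by (simp add: scaleR_2)
    with leibniz_binary[OF d m xy] e have "(1/2) *\<^sub>R jordan (jordan c x) y = jordan c w"
      using half xy w(1) by (simp add: jordan_linear scaleR_add_right)
    then have "jordan (jordan c x) y = 2 *\<^sub>R jordan c w" by (metis scaleR_half_double scaleR_2 scaleR_add_right)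
    then show "jordan c (jordan x y) = jordan (jordan c x) y" by (simp add: w(2) jordan_linear)
  qed
  show ?thesis
  proof
    show "E x = c \<cdot> x + d x" if "x \<in> A" for x
      using half[OF that] central[OF that] by (simp add: jordan_def flip: scaleR_2)
  qed (use c central in auto)
qed

end

section \<open>Projections and rank-one operators on a Hilbert space\<close>

lemma cinner_add_right: "cinner x (y + z) = cinner x y + cinner x (z :: 'a :: complex_inner)"
  by (metis cinner_add_left cinner_commute complex_cnj_add)

lemma cinner_scaleC_right: "cinner x (c *\<^sub>C y) = cnj c * cinner x (y :: 'a :: complex_inner)"
  by (metis cinner_commute cinner_scaleC_left complex_cnj_mult)

lemma cinner_diff_left: "cinner (x - y) z = cinner x z - cinner y (z :: 'a :: complex_inner)"
  using cinner_add_left[of "x - y" y z] by simp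

lemma cinner_diff_right: "cinner x (y - z) = cinner x y - cinner x (z :: 'a :: complex_inner)"
  using cinner_add_right[of x "y - z" z] by simp

lemma cinner_zero [simp]:
  "cinner 0 x = 0" "cinner x 0 = (0 :: complex)" for x :: "'a :: complex_inner"
  using cinner_diff_left[of 0 0 x] cinner_diff_right[of x 0 0] by simp_all

lemma cinner_self: "cinner x x = complex_of_real ((norm (x :: 'a :: complex_inner))\<^sup>2)"
proof -
  have "cnj (cinner x x) = cinner x x" using cinner_commute[of x x] by simp
  then have "cinner x x = complex_of_real (Re (cinner x x))"
    by (simp add: complex_eq_iff)
  then show ?thesis using cinner_self_nonneg[of x] by (simp add: norm_eq_sqrt_cinner)
qed

text \<open>Subtracting from \<open>w\<close> its component along \<open>z\<close> shortens it by exactly that component.  Both the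
Cauchy--Schwarz inequality and the orthogonality of nearest points follow from this.\<close>

lemma norm_diff_component:
  fixes w z :: "'a :: complex_inner"
  assumes "z \<noteq> 0"
  shows "(norm (w - (cinner w z / cinner z z) *\<^sub>C z))\<^sup>2 =
    (norm w)\<^sup>2 - (cmod (cinner w z))\<^sup>2 / (norm z)\<^sup>2"
proof -
  let ?a = "cinner w z" and ?r = "cinner z z"
  have r: "cnj ?r = ?r" "?r \<noteq> 0"
    using assms cinner_commute[of z z] by (simp_all add: cinner_self_eq_zero)
  have "cinner (w - (?a / ?r) *\<^sub>C z) (w - (?a / ?r) *\<^sub>C z) = cinner w w - ?a * cnj ?a / ?r"
    using r cinner_commute[of z w]
    by (simp add: cinner_diff_left cinner_diff_right cinner_scaleC_left cinner_scaleC_right field_simps)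
  then have "complex_of_real ((norm (w - (?a / ?r) *\<^sub>C z))\<^sup>2) =
    complex_of_real ((norm w)\<^sup>2 - (cmod ?a)\<^sup>2 / (norm z)\<^sup>2)"
    unfolding cinner_self[of "w - (?a / ?r) *\<^sub>C z"]
    by (simp add: cinner_self complex_norm_square flip: of_real_power)
  then show ?thesis by (simp only: of_real_eq_iff)
qed

lemma cinner_Cauchy_Schwarz:
  "cmod (cinner x y) \<le> norm x * norm (y :: 'a :: complex_inner)"
proof (cases "y = 0")
  case False
  have "0 \<le> (norm x)\<^sup>2 - (cmod (cinner x y))\<^sup>2 / (norm y)\<^sup>2"
    unfolding norm_diff_component[OF False, symmetric] by simp
  then have "(cmod (cinner x y))\<^sup>2 \<le> (norm x * norm y)\<^sup>2"
    using False by (simp add: field_simps power_mult_distrib)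
  then show ?thesis by (rule power2_le_imp_le) simp
qed simp

lemma parallelogram:
  fixes x y :: "'a :: complex_inner"
  shows "(norm (x + y))\<^sup>2 + (norm (x - y))\<^sup>2 = 2 * (norm x)\<^sup>2 + 2 * (norm y)\<^sup>2"
proof -
  have "complex_of_real ((norm (x + y))\<^sup>2 + (norm (x - y))\<^sup>2) =
      cinner (x + y) (x + y) + cinner (x - y) (x - y)"
    by (simp only: cinner_self of_real_add)
  also have "\<dots> = 2 * cinner x x + 2 * cinner y y"
    by (simp add: cinner_add_left cinner_add_right cinner_diff_left cinner_diff_right algebra_simps)
  also have "\<dots> = complex_of_real (2 * (norm x)\<^sup>2 + 2 * (norm y)\<^sup>2)"
    by (simp add: cinner_self)
  finally have "complex_of_real ((norm (x + y))\<^sup>2 + (norm (x - y))\<^sup>2) =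
      complex_of_real (2 * (norm x)\<^sup>2 + 2 * (norm y)\<^sup>2)" .
  then show ?thesis by (simp only: of_real_eq_iff)
qed

lemma csubspace_scaleR: "csubspace N \<Longrightarrow> x \<in> N \<Longrightarrow> r *\<^sub>R x \<in> N"
  by (metis complex_vector.subspace_scale scaleC_of_real)

text \<open>A minimizing sequence is Cauchy: by the parallelogram law two nearly optimal points are close to each
other, as otherwise their midpoint would be nearer to \<open>x\<close> than the distance allows.\<close>

lemma nearest_point_exists:
  fixes N :: "'a :: complex_hilbert_space set"
  assumes N: "csubspace N" and cl: "closed N"
  obtains y where "y \<in> N" "\<And>z. z \<in> N \<Longrightarrow> norm (x - y) \<le> norm (x - z)"
proof -
  define d where "d = (INF z\<in>N. norm (x - z))"
  have ne: "N \<noteq> {}" using complex_vector.subspace_0[OF N] by auto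
  have bdd: "bdd_below ((\<lambda>z. norm (x - z)) ` N)" by (rule bdd_belowI2[of _ 0]) simp
  have d_le: "d \<le> norm (x - z)" if "z \<in> N" for z
    unfolding d_def by (rule cINF_lower[OF bdd that])
  have d0: "0 \<le> d" unfolding d_def by (rule cINF_greatest[OF ne]) simp
  have "\<exists>y. y \<in> N \<and> norm (x - y) < d + inverse (real (Suc k))" for k
  proof -
    have "d < d + inverse (real (Suc k))" by simp
    then show ?thesis unfolding d_def by (subst (asm) cINF_less_iff[OF ne bdd]) auto
  qed
  then obtain y where y: "\<And>k. y k \<in> N" "\<And>k. norm (x - y k) < d + inverse (real (Suc k))"
    by metis
  have dist_sq: "(norm (a - b))\<^sup>2 \<le> 8 * d * e + 4 * e\<^sup>2"
    if ab: "a \<in> N" "b \<in> N" "norm (x - a) \<le> d + e" "norm (x - b) \<le> d + e" "0 \<le> e" for a b e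
  proof -
    have "(1/2) *\<^sub>R (a + b) \<in> N"
      using N ab complex_vector.subspace_add csubspace_scaleR by metis
    then have "2 * d \<le> 2 * norm (x - (1/2) *\<^sub>R (a + b))" using d_le by simp
    also have "\<dots> = norm (2 *\<^sub>R (x - (1/2) *\<^sub>R (a + b)))" by simp
    also have "2 *\<^sub>R (x - (1/2) *\<^sub>R (a + b)) = (x - a) + (x - b)"
      by (simp add: algebra_simps scaleR_2)
    finally have "(2 * d)\<^sup>2 \<le> (norm ((x - a) + (x - b)))\<^sup>2"
      using d0 by (intro power_mono) auto
    moreover have "(norm (x - a))\<^sup>2 \<le> (d + e)\<^sup>2" "(norm (x - b))\<^sup>2 \<le> (d + e)\<^sup>2"
      using ab by (auto intro: power_mono)
    moreover have "(norm (a - b))\<^sup>2 = (norm ((x - a) - (x - b)))\<^sup>2"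
      by (simp add: norm_minus_commute)
    ultimately show ?thesis
      using parallelogram[of "x - a" "x - b"] by (simp add: power2_eq_square algebra_simps)
  qed
  have "Cauchy y"
  proof (rule metric_CauchyI)
    fix r :: real assume r: "0 < r"
    have "(\<lambda>k. 8 * d * inverse (real (Suc k)) + 4 * (inverse (real (Suc k)))\<^sup>2) \<longlonglongrightarrow>
        8 * d * 0 + 4 * 0\<^sup>2"
      by (intro tendsto_intros LIMSEQ_inverse_real_of_nat)
    then have "\<forall>\<^sub>F k in sequentially. 8 * d * inverse (real (Suc k)) + 4 * (inverse (real (Suc k)))\<^sup>2 < r\<^sup>2"
      by (rule order_tendstoD(2)) (use r in simp)
    then obtain K where K: "8 * d * inverse (real (Suc K)) + 4 * (inverse (real (Suc K)))\<^sup>2 < r\<^sup>2"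
      by (auto simp: eventually_sequentially)
    have close: "norm (x - y k) \<le> d + inverse (real (Suc K))" if "K \<le> k" for k
    proof -
      have "inverse (real (Suc k)) \<le> inverse (real (Suc K))" using that by simp
      then show ?thesis using y(2)[of k] by linarith
    qed
    have "dist (y i) (y j) < r" if "i \<ge> K" "j \<ge> K" for i j
    proof -
      have "(norm (y i - y j))\<^sup>2 < r\<^sup>2"
        using dist_sq[OF y(1) y(1) close close, of i j] that K by simp
      then show ?thesis using r power2_less_imp_less[of "norm (y i - y j)" r] by (simp add: dist_norm)
    qed
    then show "\<exists>M. \<forall>i\<ge>M. \<forall>j\<ge>M. dist (y i) (y j) < r" by blast
  qed
  then obtain l where l: "y \<longlonglongrightarrow> l" using Cauchy_convergent_iff convergent_def by metis
  have "l \<in> N" using cl y(1) l by (meson closed_sequentially)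
  moreover have "norm (x - l) \<le> d"
  proof (rule LIMSEQ_le)
    show "(\<lambda>k. norm (x - y k)) \<longlonglongrightarrow> norm (x - l)" by (intro tendsto_intros l)
    show "(\<lambda>k. d + inverse (real (Suc k))) \<longlonglongrightarrow> d"
      using tendsto_add[OF tendsto_const[of d] LIMSEQ_inverse_real_of_nat] by simp
    show "\<exists>K. \<forall>k\<ge>K. norm (x - y k) \<le> d + inverse (real (Suc k))"
      using y(2) less_imp_le by blast
  qed
  ultimately show ?thesis using that d_le order_trans by blast
qed

text \<open>If \<open>x - y\<close> had a component along some \<open>z\<close> in \<open>N\<close>, adding it to \<open>y\<close> would give a nearer point.\<close>

lemma orthogonal_decomposition:
  fixes N :: "'a :: complex_hilbert_space set"
  assumes N: "csubspace N" and cl: "closed N"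
  obtains y where "y \<in> N" "\<And>z. z \<in> N \<Longrightarrow> cinner (x - y) z = 0"
proof -
  obtain y where y: "y \<in> N" "\<And>z. z \<in> N \<Longrightarrow> norm (x - y) \<le> norm (x - z)"
    using nearest_point_exists[OF assms] by blast
  have "cinner (x - y) z = 0" if z: "z \<in> N" for z
  proof (cases "z = 0")
    case False
    let ?t = "cinner (x - y) z / cinner z z"
    have "y + ?t *\<^sub>C z \<in> N"
      using N y(1) z complex_vector.subspace_add complex_vector.subspace_scale by metis
    from y(2)[OF this] have "(norm (x - y))\<^sup>2 \<le> (norm (x - y - ?t *\<^sub>C z))\<^sup>2"
      by (intro power_mono) (simp_all add: diff_diff_add)
    then have "(cmod (cinner (x - y) z))\<^sup>2 / (norm z)\<^sup>2 \<le> 0"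
      unfolding norm_diff_component[OF False] by simp
    then show ?thesis using False
      by (simp add: divide_le_0_iff power2_eq_square mult_le_0_iff)
  qed simp
  then show ?thesis using that y(1) by blast
qed

lemma closed_subspace_projection:
  fixes N :: "'a :: complex_hilbert_space set"
  assumes N: "csubspace N" and cl: "closed N"
  obtains P :: "'a \<Rightarrow>\<^sub>L 'a" where "\<And>c x. P (c *\<^sub>C x) = c *\<^sub>C P x" "\<And>x. P x \<in> N" "\<And>x. x \<in> N \<Longrightarrow> P x = x"
proof -
  define f where "f x = (SOME y. y \<in> N \<and> (\<forall>z\<in>N. cinner (x - y) z = 0))" for x
  have "f x \<in> N \<and> (\<forall>z\<in>N. cinner (x - f x) z = 0)" for x
  proof -
    obtain y where "y \<in> N" "\<And>z. z \<in> N \<Longrightarrow> cinner (x - y) z = 0"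
      using orthogonal_decomposition[OF assms, of x] by metis
    then show ?thesis unfolding f_def by (intro someI_ex[of "\<lambda>y. y \<in> N \<and> (\<forall>z\<in>N. cinner (x - y) z = 0)"]) blast
  qed
  then have f: "f x \<in> N" "z \<in> N \<Longrightarrow> cinner (x - f x) z = 0" for x z by auto
  have unique: "y = f x" if y: "y \<in> N" "\<And>z. z \<in> N \<Longrightarrow> cinner (x - y) z = 0" for x y
  proof -
    have "f x - y \<in> N" using complex_vector.subspace_diff[OF N f(1) y(1)] .
    then have "cinner ((x - y) - (x - f x)) (f x - y) = 0"
      by (subst cinner_diff_left) (simp add: y(2) f(2))
    then show ?thesis by (simp add: cinner_self_eq_zero)
  qed
  have add: "f (x + y) = f x + f y" for x y
    by (rule unique[symmetric])
      (simp_all add: complex_vector.subspace_add[OF N] f add_diff_add cinner_add_left del: add_diff_eq)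
  have scale: "f (c *\<^sub>C x) = c *\<^sub>C f x" for c x
    by (rule unique[symmetric])
      (simp_all add: complex_vector.subspace_scale[OF N] f cinner_scaleC_left
        flip: complex_vector.scale_right_diff_distrib)
  have "norm (f x) \<le> norm x * 1" for x
  proof -
    have "cinner (f x) (f x) = cinner x (f x)"
      using f(2)[OF f(1), of x x] by (simp add: cinner_diff_left)
    then have "cmod (cinner (f x) (f x)) \<le> norm x * norm (f x)"
      using cinner_Cauchy_Schwarz by simp
    then have "norm (f x) * norm (f x) \<le> norm x * norm (f x)"
      by (simp add: cinner_self power2_eq_square norm_mult)
    then show ?thesis by (cases "f x = 0") auto
  qed
  then have "bounded_linear f"
    by (intro bounded_linear_intro[of f 1]) (simp_all add: add scale flip: scaleC_of_real)
  moreover have "f x = x" if "x \<in> N" for x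
    by (rule unique[symmetric]) (use that in simp_all)
  ultimately show ?thesis
    using that[of "Blinfun f"] f(1) scale by (simp add: bounded_linear_Blinfun_apply)
qed

lemma rank_one_operator:
  fixes x y :: "'a :: complex_hilbert_space"
  obtains T :: "'a \<Rightarrow>\<^sub>L 'a" where "\<And>z. T z = cinner z y *\<^sub>C x"
proof -
  have "bounded_linear (\<lambda>z. cinner z y *\<^sub>C x)"
  proof (rule bounded_linear_intro)
    fix z w :: 'a and r :: real
    show "cinner (z + w) y *\<^sub>C x = cinner z y *\<^sub>C x + cinner w y *\<^sub>C x"
      by (simp add: cinner_add_left scaleC_add_left)
    show "cinner (r *\<^sub>R z) y *\<^sub>C x = r *\<^sub>R cinner z y *\<^sub>C x"
      by (simp add: cinner_scaleC_left scaleC_scaleC flip: scaleC_of_real)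
    show "norm (cinner z y *\<^sub>C x) \<le> norm z * (norm y * norm x)"
      using mult_right_mono[OF cinner_Cauchy_Schwarz norm_ge_zero, of z y x]
      by (simp add: norm_scaleC mult.assoc)
  qed
  then show ?thesis using that[of "Blinfun (\<lambda>z. cinner z y *\<^sub>C x)"]
    by (simp add: bounded_linear_Blinfun_apply)
qed

section \<open>Nest algebras are triangular\<close>

interpretation blinfun_compose: bounded_bilinear "(o\<^sub>L)"
  by (rule bounded_bilinear_blinfun_compose)

lemma nest_algebra_simps [simp]:
  "x \<otimes>\<^bsub>nest_algebra \<N>\<^esub> y = x o\<^sub>L y" "x \<oplus>\<^bsub>nest_algebra \<N>\<^esub> y = x + y" "\<zero>\<^bsub>nest_algebra \<N>\<^esub> = 0"
  by (simp_all add: nest_algebra_def)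

lemma nest_algebra_carrier_iff:
  "T \<in> carrier (nest_algebra \<N>) \<longleftrightarrow>
    (\<forall>c x. T (c *\<^sub>C x) = c *\<^sub>C T x) \<and> (\<forall>N\<in>\<N>. \<forall>x\<in>N. T x \<in> N)"
  by (simp add: nest_algebra_def image_subset_iff)

text \<open>Any bounded complex-linear projection onto \<open>N\<close> belongs to the nest algebra: it fixes the nest
subspaces inside \<open>N\<close> pointwise and maps the larger ones into \<open>N\<close>.\<close>

locale nest_projection =
  fixes \<N> :: "'h :: complex_hilbert_space set set" and N :: "'h set" and P :: "'h \<Rightarrow>\<^sub>L 'h"
  assumes nest: "nest \<N>" and N: "N \<in> \<N>" "N \<noteq> {0}" "N \<noteq> UNIV"
    and P_scaleC: "P (c *\<^sub>C x) = c *\<^sub>C P x" and P_range: "P x \<in> N"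
    and P_fixes: "x \<in> N \<Longrightarrow> P x = x"
begin

abbreviation A where "A \<equiv> carrier (nest_algebra \<N>)"
abbreviation Q where "Q \<equiv> id_blinfun - P"

lemma csubspace: "M \<in> \<N> \<Longrightarrow> csubspace M" using nest by (simp add: nest_def)

lemma zero_in: "M \<in> \<N> \<Longrightarrow> 0 \<in> M" using csubspace complex_vector.subspace_0 by blast

lemma P_P [simp]: "P (P x) = P x" by (rule P_fixes[OF P_range])

lemma Q_P [simp]: "Q (P x) = 0" "P (Q x) = 0" "Q (Q x) = Q x"
  by (simp_all add: blinfun.diff_left blinfun.diff_right)

lemma Q_N: "x \<in> N \<Longrightarrow> Q x = 0" by (simp add: blinfun.diff_left P_fixes)

lemma chain: "M \<in> \<N> \<Longrightarrow> M \<subseteq> N \<or> N \<subseteq> M" using nest N by (auto simp: nest_def)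

lemma corner_in_A:
  fixes T :: "'h \<Rightarrow>\<^sub>L 'h"
  assumes "\<And>c x. T (c *\<^sub>C x) = c *\<^sub>C T x"
  shows "P o\<^sub>L T o\<^sub>L Q \<in> A"
  unfolding nest_algebra_carrier_iff
proof safe
  show "(P o\<^sub>L T o\<^sub>L Q) (c *\<^sub>C x) = c *\<^sub>C (P o\<^sub>L T o\<^sub>L Q) x" for c x
    by (simp add: assms P_scaleC blinfun.diff_left flip: complex_vector.scale_right_diff_distrib)
  fix M x assume M: "M \<in> \<N>" "x \<in> M"
  show "(P o\<^sub>L T o\<^sub>L Q) x \<in> M"
    using chain[OF M(1)]
  proof
    assume "M \<subseteq> N"
    then have "Q x = 0" using M Q_N by blast
    then show ?thesis using zero_in[OF M(1)] by (simp add: blinfun.zero_right)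
  next
    assume "N \<subseteq> M" then show ?thesis using P_range by auto
  qed
qed

lemma P_in_A: "P \<in> A"
  unfolding nest_algebra_carrier_iff
proof safe
  fix M x assume M: "M \<in> \<N>" "x \<in> M"
  show "P x \<in> M"
    using chain[OF M(1)] M(2) P_range[of x] P_fixes[of x] by auto
qed (rule P_scaleC)

lemma subspace_A: "subspace A"
  unfolding subspace_def
  by (auto simp: nest_algebra_carrier_iff blinfun.add_left blinfun.scaleR_left scaleC_add_right zero_in
      complex_vector.subspace_add csubspace csubspace_scaleR scaleC_scaleC mult.commute
      scaleC_of_real[symmetric] complex_vector.subspace_scale)

text \<open>The supply of corner elements used for faithfulness and for the centre.\<close>

lemma rank_one_corner:
  obtains T :: "'h \<Rightarrow>\<^sub>L 'h" where "T \<in> A" "\<And>z. (P o\<^sub>L T o\<^sub>L Q) z = cinner (Q z) y *\<^sub>C P x"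
proof -
  obtain T :: "'h \<Rightarrow>\<^sub>L 'h" where T: "\<And>z. T z = cinner z y *\<^sub>C x" using rank_one_operator[of y x] by metis
  have "P o\<^sub>L T o\<^sub>L Q \<in> A" by (rule corner_in_A) (simp add: T cinner_scaleC_left scaleC_scaleC)
  then show ?thesis by (rule that) (simp add: T P_scaleC)
qed

sublocale triangular_algebra "(o\<^sub>L)" A P Q
proof
  have compl: "x - y \<in> A" if "x \<in> A" "y \<in> A" for x y using subspace_diff[OF subspace_A that] .
  have "id_blinfun \<in> A" by (simp add: nest_algebra_carrier_iff)
  then show "Q \<in> A" using P_in_A compl by blast
  fix x assume x: "x \<in> A"
  show "Q o\<^sub>L x o\<^sub>L P = 0"
  proof (rule blinfun_eqI)
    fix v
    have "x (P v) \<in> N" using x N(1) P_range by (auto simp: nest_algebra_carrier_iff)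
    then show "(Q o\<^sub>L x o\<^sub>L P) v = blinfun_apply 0 v" by (simp add: Q_N)
  qed
  show "P o\<^sub>L x o\<^sub>L P = 0" if *: "\<And>a. a \<in> A \<Longrightarrow> P o\<^sub>L x o\<^sub>L P o\<^sub>L (P o\<^sub>L a o\<^sub>L Q) = 0"
  proof (rule blinfun_eqI)
    fix v
    obtain z where z: "z \<notin> N" using N(3) by blast
    then have Qz: "Q z \<noteq> 0" using P_range[of z] by (auto simp: blinfun.diff_left)
    obtain T :: "'h \<Rightarrow>\<^sub>L 'h" where T: "T \<in> A" "\<And>w. (P o\<^sub>L T o\<^sub>L Q) w = cinner (Q w) (Q z) *\<^sub>C P v"
      using rank_one_corner[of "Q z" v] by metis
    have "(P o\<^sub>L x o\<^sub>L P o\<^sub>L (P o\<^sub>L T o\<^sub>L Q)) z = 0" using *[OF T(1)] by simp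
    then have "(P o\<^sub>L x o\<^sub>L P) (cinner (Q z) (Q z) *\<^sub>C P v) = 0"
      unfolding T(2)[symmetric] by simp
    then have "cinner (Q z) (Q z) *\<^sub>C P (x (P v)) = 0"
      using x by (simp add: P_scaleC nest_algebra_carrier_iff)
    then show "(P o\<^sub>L x o\<^sub>L P) v = blinfun_apply 0 v"
      using Qz by (simp add: cinner_self_eq_zero)
  qed
  show "Q o\<^sub>L x o\<^sub>L Q = 0" if *: "\<And>a. a \<in> A \<Longrightarrow> P o\<^sub>L a o\<^sub>L Q o\<^sub>L (Q o\<^sub>L x o\<^sub>L Q) = 0"
  proof (rule blinfun_eqI)
    fix v
    obtain u where u: "u \<in> N" "u \<noteq> 0" using N(2) zero_in[OF N(1)] by blast
    obtain T :: "'h \<Rightarrow>\<^sub>L 'h" where T: "T \<in> A" "\<And>w. (P o\<^sub>L T o\<^sub>L Q) w = cinner (Q w) (Q (x (Q v))) *\<^sub>C P u"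
      using rank_one_corner[of "Q (x (Q v))" u] by metis
    have "(P o\<^sub>L T o\<^sub>L Q o\<^sub>L (Q o\<^sub>L x o\<^sub>L Q)) v = 0" using *[OF T(1)] by simp
    then have "(P o\<^sub>L T o\<^sub>L Q) (Q (x (Q v))) = 0" by simp
    then have "cinner (Q (x (Q v))) (Q (x (Q v))) *\<^sub>C u = 0"
      unfolding T(2) using u by (simp add: P_fixes)
    then show "(Q o\<^sub>L x o\<^sub>L Q) v = blinfun_apply 0 v"
      using u(2) by (simp add: cinner_self_eq_zero)
  qed
qed (auto simp: blinfun_compose.add_left blinfun_compose.add_right blinfun_compose.scaleR_left
    blinfun_compose.scaleR_right subspace_A P_in_A[unfolded nest_algebra_carrier_iff] nest_algebra_carrier_iff
    blinfun.diff_left blinfun.diff_right blinfun.add_left intro!: blinfun_eqI)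

text \<open>Commuting with \<open>z \<mapsto> \<langle>Q z, y\<rangle> P x\<close> means \<open>\<langle>Q w, y\<rangle> c P x = \<langle>Q c w, y\<rangle> P x\<close>.  One choice of \<open>w\<close> and \<open>y\<close> with
\<open>\<langle>Q w, y\<rangle> \<noteq> 0\<close> makes \<open>c\<close> a scalar on \<open>N\<close>; one nonzero \<open>P x\<close> then gives the same scalar on the range of \<open>Q\<close>.\<close>

lemma center_scalar:
  assumes c: "c \<in> A" and comm: "\<And>x. x \<in> A \<Longrightarrow> c o\<^sub>L x = x o\<^sub>L c"
  obtains \<mu> where "c = scalar_operator \<mu>"
proof -
  obtain z where "z \<notin> N" using N(3) by blast
  then have Qz: "Q z \<noteq> 0" using P_range[of z] by (auto simp: blinfun.diff_left)
  obtain u where u: "u \<in> N" "u \<noteq> 0" using N(2) zero_in[OF N(1)] by blast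
  have c_scale: "c (a *\<^sub>C x) = a *\<^sub>C c x" for a x
    using c by (simp add: nest_algebra_carrier_iff)
  have corner: "cinner (Q w) y *\<^sub>C c (P x) = cinner (Q (c w)) y *\<^sub>C P x" for w x y
  proof -
    obtain T :: "'h \<Rightarrow>\<^sub>L 'h" where T: "T \<in> A" "\<And>z. (P o\<^sub>L T o\<^sub>L Q) z = cinner (Q z) y *\<^sub>C P x"
      using rank_one_corner[of y x] by metis
    then have "P o\<^sub>L T o\<^sub>L Q \<in> A" by (intro mult_closed p_closed q_closed)
    from comm[OF this] have "c ((P o\<^sub>L T o\<^sub>L Q) w) = (P o\<^sub>L T o\<^sub>L Q) (c w)"
      by (metis blinfun_apply_blinfun_compose)
    then show ?thesis unfolding T(2) by (simp add: c_scale)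
  qed
  define r where "r = cinner (Q z) (Q z)"
  have r: "r \<noteq> 0" using Qz by (simp add: r_def cinner_self_eq_zero)
  define \<mu> where "\<mu> = cinner (Q (c z)) (Q z) / r"
  have P_part: "c (P x) = \<mu> *\<^sub>C P x" for x
  proof -
    have "(1 / r) *\<^sub>C (r *\<^sub>C c (P x)) = (1 / r) *\<^sub>C (\<mu> * r) *\<^sub>C P x"
      using corner[of z "Q z" x] r by (simp add: \<mu>_def r_def[symmetric])
    then show ?thesis using r by (simp add: scaleC_scaleC scaleC_one)
  qed
  have Q_part: "Q (c w) = \<mu> *\<^sub>C Q w" for w
  proof -
    let ?y = "Q (c w) - \<mu> *\<^sub>C Q w"
    have "(cinner (Q w) ?y * \<mu>) *\<^sub>C u = cinner (Q (c w)) ?y *\<^sub>C u"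
      using corner[of w ?y u] P_part[of u] u by (simp add: P_fixes scaleC_scaleC)
    then have "cinner (Q w) ?y * \<mu> = cinner (Q (c w)) ?y" using u(2) by simp
    then have "cinner ?y ?y = 0"
      unfolding cinner_diff_left[of "Q (c w)"] cinner_scaleC_left by (simp add: mult.commute)
    then show ?thesis by (simp add: cinner_self_eq_zero)
  qed
  have "c = scalar_operator \<mu>"
  proof (rule blinfun_eqI)
    fix w
    have "P (c w) = c (P w)"
      using comm[OF P_in_A] by (metis blinfun_apply_blinfun_compose)
    then have "c w = c (P w) + Q (c w)" by (simp add: blinfun.diff_left)
    also have "\<dots> = \<mu> *\<^sub>C (P w + Q w)" unfolding P_part Q_part by (rule scaleC_add_right[symmetric])
    finally show "c w = scalar_operator \<mu> w"
      by (simp add: blinfun.diff_left scalar_operator.rep_eq)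
  qed
  then show ?thesis by (rule that)
qed

end

section \<open>Generalized Jordan derivations of nest algebras\<close>

lemma jordan_q_foldl:
  "jordan_q R (Suc m) t = foldl (jordan_product R) (t 1) (map t [2..<m + 2])"
  by (induction m) simp_all

lemma leibniz_fold_snoc:
  "leibniz_fold f d v x (ys @ [y]) = f (leibniz_fold f d v x ys) y + f (foldl f x ys) (d y)"
  by (induction ys arbitrary: v x) simp_all

lemma nest_algebra_jordan_product: "jordan_product (nest_algebra \<N>) x y = (x o\<^sub>L y) + (y o\<^sub>L x)"
  by (simp add: jordan_product_def)

lemma jordan_q_cong:
  "(\<And>i. 1 \<le> i \<Longrightarrow> i \<le> Suc m \<Longrightarrow> s i = t i) \<Longrightarrow> jordan_q R (Suc m) s = jordan_q R (Suc m) t"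
  by (induction m) simp_all

text \<open>The Jordan product distributes over the sum, so appending an entry multiplies every earlier summand
and adds the one in which \<open>d\<close> acts on the new entry: this is the recursion of \<open>leibniz_fold\<close>.\<close>

lemma leibniz_sum_eq_fold:
  fixes \<N> :: "'h::complex_hilbert_space set set"
  defines "R \<equiv> nest_algebra \<N>"
  shows "jordan_q R (Suc m) (t(1 := v)) + (\<Sum>i\<in>{2..Suc m}. jordan_q R (Suc m) (t(i := d (t i)))) =
    leibniz_fold (jordan_product R) d v (t 1) (map t [2..<m + 2])"
proof (induction m)
  case (Suc m)
  let ?jordan = "jordan_product R"
  have jordan_add: "?jordan (x + y) z = ?jordan x z + ?jordan y z" for x y z
    by (simp add: R_def nest_algebra_jordan_product blinfun_compose.add_left blinfun_compose.add_right algebra_simps)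
  have jordan_0: "?jordan 0 z = 0" for z by (simp add: R_def nest_algebra_jordan_product)
  have jordan_sum: "?jordan (\<Sum>i\<in>S. g i) z = (\<Sum>i\<in>S. ?jordan (g i) z)" if "finite S" for S :: "nat set" and g z
    using that by induction (simp_all add: jordan_0 jordan_add)
  have "(\<Sum>i\<in>{2..Suc (Suc m)}. jordan_q R (Suc (Suc m)) (t(i := d (t i)))) =
    (\<Sum>i\<in>{2..Suc m}. jordan_q R (Suc (Suc m)) (t(i := d (t i)))) +
    jordan_q R (Suc (Suc m)) (t(Suc (Suc m) := d (t (Suc (Suc m)))))"
    by simp
  also have "(\<Sum>i\<in>{2..Suc m}. jordan_q R (Suc (Suc m)) (t(i := d (t i)))) =
    ?jordan (\<Sum>i\<in>{2..Suc m}. jordan_q R (Suc m) (t(i := d (t i)))) (t (Suc (Suc m)))"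
    unfolding jordan_sum[OF finite_atLeastAtMost] by (rule sum.cong) auto
  also have "jordan_q R (Suc (Suc m)) (t(Suc (Suc m) := d (t (Suc (Suc m))))) =
    ?jordan (jordan_q R (Suc m) t) (d (t (Suc (Suc m))))"
    using jordan_q_cong[of m "t(Suc (Suc m) := d (t (Suc (Suc m))))" t R] by simp
  finally show ?case
    using Suc.IH[symmetric] by (simp add: leibniz_fold_snoc jordan_add jordan_q_foldl add.assoc)
qed simp

lemma jordan_q_closed:
  assumes "nest \<N>" "t \<in> {1..Suc m} \<rightarrow> carrier (nest_algebra \<N>)"
  shows "jordan_q (nest_algebra \<N>) (Suc m) t \<in> carrier (nest_algebra \<N>)"
proof -
  interpret ring "nest_algebra \<N>" by (rule ring_nest_algebra[OF assms(1)])
  show ?thesis using assms(2)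
    by (induction m) (auto simp: jordan_product_def Pi_iff simp del: nest_algebra_simps)
qed

lemma nest_algebra_finsum:
  assumes "nest \<N>" "finite S" "f \<in> S \<rightarrow> carrier (nest_algebra \<N>)"
  shows "(\<Oplus>\<^bsub>nest_algebra \<N>\<^esub>i\<in>S. f i) = (\<Sum>i\<in>S. f i)"
proof -
  interpret ring "nest_algebra \<N>" by (rule ring_nest_algebra[OF assms(1)])
  show ?thesis using assms(2,3)
    by induction (simp_all add: Pi_iff)
qed

lemma generalized_leibniz_on:
  assumes nest: "nest \<N>"
    and maps: "E \<in> carrier (nest_algebra \<N>) \<rightarrow> carrier (nest_algebra \<N>)"
      "d \<in> carrier (nest_algebra \<N>) \<rightarrow> carrier (nest_algebra \<N>)"
    and E: "\<And>t. t \<in> {1..Suc m} \<rightarrow> carrier (nest_algebra \<N>) \<Longrightarrow>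
      E (jordan_q (nest_algebra \<N>) (Suc m) t) =
        jordan_q (nest_algebra \<N>) (Suc m) (t(1 := E (t 1))) +
        (\<Oplus>\<^bsub>nest_algebra \<N>\<^esub>i\<in>{2..Suc m}. jordan_q (nest_algebra \<N>) (Suc m) (t(i := d (t i))))"
  shows "leibniz_on (jordan_product (nest_algebra \<N>)) (carrier (nest_algebra \<N>)) m E d"
  unfolding leibniz_on_def
proof (intro conjI maps ballI allI impI)
  let ?R = "nest_algebra \<N>"
  fix x ys assume x: "x \<in> carrier ?R" and ys: "set ys \<subseteq> carrier ?R" "length ys = m"
  define t where "t i = (if i = 1 then x else ys ! (i - 2))" for i :: nat
  have t: "t \<in> {1..Suc m} \<rightarrow> carrier ?R" using x ys by (auto simp: t_def subset_iff)
  have t1: "t 1 = x" and t2: "map t [2..<m + 2] = ys"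
    using ys(2) by (auto simp: t_def intro!: nth_equalityI simp del: upt_Suc)
  have "(\<Oplus>\<^bsub>?R\<^esub>i\<in>{2..Suc m}. jordan_q ?R (Suc m) (t(i := d (t i)))) =
      (\<Sum>i\<in>{2..Suc m}. jordan_q ?R (Suc m) (t(i := d (t i))))"
  proof (rule nest_algebra_finsum[OF nest])
    show "(\<lambda>i. jordan_q ?R (Suc m) (t(i := d (t i)))) \<in> {2..Suc m} \<rightarrow> carrier ?R"
    proof
      fix i assume "i \<in> {2..Suc m}"
      then have "t(i := d (t i)) \<in> {1..Suc m} \<rightarrow> carrier ?R" using t maps by (auto simp: Pi_iff)
      then show "jordan_q ?R (Suc m) (t(i := d (t i))) \<in> carrier ?R"
        by (rule jordan_q_closed[OF nest])
    qed
  qed simp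
  then have "E (jordan_q ?R (Suc m) t) =
      leibniz_fold (jordan_product ?R) d (E x) (t 1) (map t [2..<m + 2])"
    unfolding E[OF t] t1 by (simp only: leibniz_sum_eq_fold t1)
  then show "E (foldl (jordan_product ?R) x ys) = leibniz_fold (jordan_product ?R) d (E x) x ys"
    unfolding jordan_q_foldl t1 t2 .
qed

lemma mult_jordan_derivation_leibniz_on:
  assumes nest: "nest \<N>" and d: "mult_jordan_derivation (nest_algebra \<N>) (Suc m) d"
  shows "leibniz_on (jordan_product (nest_algebra \<N>)) (carrier (nest_algebra \<N>)) m d d"
proof (rule generalized_leibniz_on[OF nest])
  let ?R = "nest_algebra \<N>"
  show maps: "d \<in> carrier ?R \<rightarrow> carrier ?R" "d \<in> carrier ?R \<rightarrow> carrier ?R"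
    using d by (simp_all add: mult_jordan_derivation_def)
  fix t assume t: "t \<in> {1..Suc m} \<rightarrow> carrier ?R"
  interpret ring ?R by (rule ring_nest_algebra[OF nest])
  have closed: "jordan_q ?R (Suc m) (t(i := d (t i))) \<in> carrier ?R" if "i \<in> {1..Suc m}" for i
  proof -
    have "t(i := d (t i)) \<in> {1..Suc m} \<rightarrow> carrier ?R" using t maps that by (auto simp: Pi_iff)
    then show ?thesis by (rule jordan_q_closed[OF nest])
  qed
  have "{1..Suc m} = insert 1 {2..Suc m}" by auto
  moreover have "(\<Oplus>\<^bsub>?R\<^esub>i\<in>insert 1 {2..Suc m}. jordan_q ?R (Suc m) (t(i := d (t i)))) =
      jordan_q ?R (Suc m) (t(1 := d (t 1))) +
      (\<Oplus>\<^bsub>?R\<^esub>i\<in>{2..Suc m}. jordan_q ?R (Suc m) (t(i := d (t i))))"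
    by (subst finsum_insert) (use closed in auto)
  ultimately show "d (jordan_q ?R (Suc m) t) = jordan_q ?R (Suc m) (t(1 := d (t 1))) +
      (\<Oplus>\<^bsub>?R\<^esub>i\<in>{2..Suc m}. jordan_q ?R (Suc m) (t(i := d (t i))))"
    using d t by (simp add: mult_jordan_derivation_def)
qed

theorem corollary4p4:
  fixes n :: nat
    and \<N> :: "'h :: complex_hilbert_space set set"
    and \<Delta> :: "('h \<Rightarrow>\<^sub>L 'h) \<Rightarrow> ('h \<Rightarrow>\<^sub>L 'h)"
  assumes "n \<ge> 2"
    and "nontrivial_nest \<N>"
    and "mult_generalized_jordan_derivation (nest_algebra \<N>) n \<Delta>"
  shows "\<exists>\<mu> \<in> range (scalar_operator :: complex \<Rightarrow> 'h \<Rightarrow>\<^sub>L 'h). \<exists>\<delta>.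
    derivation (nest_algebra \<N>) \<delta> \<and>
    (\<forall>t \<in> carrier (nest_algebra \<N>).
      \<Delta> t = (\<mu> \<otimes>\<^bsub>nest_algebra \<N>\<^esub> t) \<oplus>\<^bsub>nest_algebra \<N>\<^esub> \<delta> t)"
proof -
  let ?R = "nest_algebra \<N>"
  have nest: "nest \<N>" using assms(2) by (simp add: nontrivial_nest_def)
  then have "{0} \<in> \<N>" "UNIV \<in> \<N>" by (simp_all add: nest_def)
  then obtain N where N: "N \<in> \<N>" "N \<noteq> {0}" "N \<noteq> UNIV"
    using assms(2) unfolding nontrivial_nest_def by blast
  then have "csubspace N" "closed N" using nest by (simp_all add: nest_def)
  then obtain P :: "'h \<Rightarrow>\<^sub>L 'h" where
    "\<And>c x. P (c *\<^sub>C x) = c *\<^sub>C P x" "\<And>x. P x \<in> N" "\<And>x. x \<in> N \<Longrightarrow> P x = x"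
    using closed_subspace_projection by metis
  then interpret nest_projection \<N> N P
    using nest N by unfold_locales
  obtain m where m: "n = Suc m" "m \<ge> 1" using assms(1) by (cases n) auto
  have jordan: "jordan = jordan_product ?R"
    by (intro ext) (simp add: jordan_def nest_algebra_jordan_product)
  obtain d where d: "mult_jordan_derivation ?R (Suc m) d"
    and \<Delta>: "\<And>t. t \<in> {1..Suc m} \<rightarrow> carrier ?R \<Longrightarrow>
        \<Delta> (jordan_q ?R (Suc m) t) = jordan_q ?R (Suc m) (t(1 := \<Delta> (t 1))) +
          (\<Oplus>\<^bsub>?R\<^esub>i\<in>{2..Suc m}. jordan_q ?R (Suc m) (t(i := d (t i))))"
    using assms(3) unfolding mult_generalized_jordan_derivation_def m(1) by auto
  have maps: "d \<in> A \<rightarrow> A" "\<Delta> \<in> A \<rightarrow> A"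
    using d assms(3) by (simp_all add: mult_jordan_derivation_def mult_generalized_jordan_derivation_def)
  have leib_d: "leibniz_on jordan A m d d"
    unfolding jordan by (rule mult_jordan_derivation_leibniz_on[OF nest d])
  have leib_\<Delta>: "leibniz_on jordan A m \<Delta> d"
    unfolding jordan by (rule generalized_leibniz_on[OF nest maps(2,1) \<Delta>])
  obtain c where c: "c \<in> A" "\<And>x. x \<in> A \<Longrightarrow> c o\<^sub>L x = x o\<^sub>L c" "\<And>x. x \<in> A \<Longrightarrow> \<Delta> x = (c o\<^sub>L x) + d x"
    using generalized_jordan_n_derivation[OF leib_\<Delta> leib_d m(2)] by metis
  obtain \<mu> where \<mu>: "c = scalar_operator \<mu>" using center_scalar[OF c(1,2)] by metis
  have "derivation ?R d"
    unfolding derivation_def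
    using maps(1) jordan_n_derivation_is_derivation[OF leib_d m(2)] by simp
  then show ?thesis using c(3) unfolding \<mu> by auto
qed

end
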